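(* Let $A$ be a boundedly approximately contractible Banach algebra. Then $A$ has a bounded approximate identity.
   Context: Let $A$ be a Banach algebra and $X$ a Banach $A$-bimodule. A derivation $D:A\to X$ is a linear map with $D(ab)=a\cdot D(b)+D(a)\cdot b$; it is inner if $D(a)=a\cdot x-x\cdot a$ for some $x\in X$. $A$ is boundedly approximately contractible if for every Banach $A$-bimodule $X$ and every continuous derivation $D:A\to X$ there is a net $(D_i)$ of inner derivations $A\to X$, bounded in the operator norm of $\mathcal L(A,X)$, such that $\lim_i D_i(a)=D(a)$ in norm for all $a\in A$. A bounded approximate identity means a norm-bounded net $(e_\lambda)$ in $A$ with $e_\lambda a\to a$ and $ae_\lambda\to a$ in norm for all $a\in A$. *)

theory Defs
  imports "HOL-Analysis.Analysis"
begin

section \<open>Banach algebras and Banach bimodules\<close>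

text \<open>
  The scalars form a complete normed field \<open>'k\<close> containing the reals, that is (by the
  Gelfand--Mazur theorem) the reals or the complex numbers. The type classes make \<open>'a\<close> a real
  Banach algebra, not necessarily unital; \<open>scl\<close> extends its scalar multiplication to \<open>'k\<close>.
\<close>

locale banach_algebra = vector_space scl
  for scl :: "'k::{real_normed_field,banach} \<Rightarrow> 'a::{real_normed_algebra,banach} \<Rightarrow> 'a" +
  assumes scale_of_real: "scl (of_real r) a = r *\<^sub>R a"
    and norm_scale: "norm (scl c a) = norm c * norm a"
    and scale_mult_left: "scl c a * b = scl c (a * b)"
    and scale_mult_right: "a * scl c b = scl c (a * b)"

lemma banach_algebra_real:
  "banach_algebra (scaleR :: real \<Rightarrow> 'a::{real_normed_algebra,banach} \<Rightarrow> 'a)"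
  by unfold_locales (auto simp: algebra_simps)

lemma banach_algebra_field:
  "banach_algebra ((*) :: 'k::{real_normed_field,banach} \<Rightarrow> 'k \<Rightarrow> 'k)"
  by unfold_locales (auto simp: algebra_simps scaleR_conv_of_real norm_mult)

text \<open>
  The definition of bounded approximate contractibility quantifies over all bimodules, so bimodules
  have an explicit carrier set and explicit operations instead of being types. The operations are
  only meaningful on the carrier.
\<close>

record ('k, 'a, 'x) bimod =
  bcarrier :: "'x set"
  badd :: "'x \<Rightarrow> 'x \<Rightarrow> 'x" (infixl "\<boxplus>\<index>" 65)
  bzero :: 'x ("\<zero>\<index>")
  bscale :: "'k \<Rightarrow> 'x \<Rightarrow> 'x" (infixr "\<odot>\<index>" 75)
  bnorm :: "'x \<Rightarrow> real"
  lact :: "'a \<Rightarrow> 'x \<Rightarrow> 'x" (infixr "\<rhd>\<index>" 75)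
  ract :: "'x \<Rightarrow> 'a \<Rightarrow> 'x" (infixl "\<lhd>\<index>" 75)

definition bdiff :: "('k::ring_1, 'a, 'x) bimod \<Rightarrow> 'x \<Rightarrow> 'x \<Rightarrow> 'x" (infixl "\<boxminus>\<index>" 65)
  where "bdiff M x y = badd M x (bscale M (- 1) y)"

text \<open>
  Additive inverses, and nonnegativity of the norm, follow from the remaining axioms. The module
  actions are jointly continuous; neither contractivity nor unitality is required.
\<close>

locale banach_bimodule = banach_algebra scl
  for scl :: "'k::{real_normed_field,banach} \<Rightarrow> 'a::{real_normed_algebra,banach} \<Rightarrow> 'a" +
  fixes M :: "('k, 'a, 'x) bimod" (structure)
  assumes zero_in: "\<zero> \<in> bcarrier M"
    and add_in: "\<lbrakk>x \<in> bcarrier M; y \<in> bcarrier M\<rbrakk> \<Longrightarrow> x \<boxplus> y \<in> bcarrier M"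
    and scale_in: "x \<in> bcarrier M \<Longrightarrow> c \<odot> x \<in> bcarrier M"
    and add_assoc': "\<lbrakk>x \<in> bcarrier M; y \<in> bcarrier M; z \<in> bcarrier M\<rbrakk>
          \<Longrightarrow> (x \<boxplus> y) \<boxplus> z = x \<boxplus> (y \<boxplus> z)"
    and add_commute': "\<lbrakk>x \<in> bcarrier M; y \<in> bcarrier M\<rbrakk> \<Longrightarrow> x \<boxplus> y = y \<boxplus> x"
    and zero_add': "x \<in> bcarrier M \<Longrightarrow> \<zero> \<boxplus> x = x"
    and scale_add': "\<lbrakk>x \<in> bcarrier M; y \<in> bcarrier M\<rbrakk> \<Longrightarrow> c \<odot> (x \<boxplus> y) = c \<odot> x \<boxplus> c \<odot> y"
    and add_scale': "x \<in> bcarrier M \<Longrightarrow> (c + d) \<odot> x = c \<odot> x \<boxplus> d \<odot> x"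
    and scale_scale': "x \<in> bcarrier M \<Longrightarrow> c \<odot> (d \<odot> x) = (c * d) \<odot> x"
    and one_scale': "x \<in> bcarrier M \<Longrightarrow> 1 \<odot> x = x"
    and norm_eq_zero': "x \<in> bcarrier M \<Longrightarrow> bnorm M x = 0 \<longleftrightarrow> x = \<zero>"
    and norm_scale': "x \<in> bcarrier M \<Longrightarrow> bnorm M (c \<odot> x) = norm c * bnorm M x"
    and norm_triangle': "\<lbrakk>x \<in> bcarrier M; y \<in> bcarrier M\<rbrakk>
          \<Longrightarrow> bnorm M (x \<boxplus> y) \<le> bnorm M x + bnorm M y"
    and complete': "\<lbrakk>range s \<subseteq> bcarrier M;
            \<forall>\<epsilon>>0. \<exists>N::nat. \<forall>m\<ge>N. \<forall>n\<ge>N. bnorm M (s m \<boxminus> s n) < \<epsilon>\<rbrakk>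
          \<Longrightarrow> \<exists>l\<in>bcarrier M. (\<lambda>n. bnorm M (s n \<boxminus> l)) \<longlonglongrightarrow> 0"
    and lact_in: "x \<in> bcarrier M \<Longrightarrow> a \<rhd> x \<in> bcarrier M"
    and ract_in: "x \<in> bcarrier M \<Longrightarrow> x \<lhd> a \<in> bcarrier M"
    and lact_add: "\<lbrakk>x \<in> bcarrier M; y \<in> bcarrier M\<rbrakk> \<Longrightarrow> a \<rhd> (x \<boxplus> y) = a \<rhd> x \<boxplus> a \<rhd> y"
    and ract_add: "\<lbrakk>x \<in> bcarrier M; y \<in> bcarrier M\<rbrakk> \<Longrightarrow> (x \<boxplus> y) \<lhd> a = x \<lhd> a \<boxplus> y \<lhd> a"
    and add_lact: "x \<in> bcarrier M \<Longrightarrow> (a + b) \<rhd> x = a \<rhd> x \<boxplus> b \<rhd> x"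
    and add_ract: "x \<in> bcarrier M \<Longrightarrow> x \<lhd> (a + b) = x \<lhd> a \<boxplus> x \<lhd> b"
    and lact_scale: "x \<in> bcarrier M \<Longrightarrow> a \<rhd> (c \<odot> x) = c \<odot> (a \<rhd> x)"
    and ract_scale: "x \<in> bcarrier M \<Longrightarrow> (c \<odot> x) \<lhd> a = c \<odot> (x \<lhd> a)"
    and scale_lact: "x \<in> bcarrier M \<Longrightarrow> scl c a \<rhd> x = c \<odot> (a \<rhd> x)"
    and scale_ract: "x \<in> bcarrier M \<Longrightarrow> x \<lhd> scl c a = c \<odot> (x \<lhd> a)"
    and mult_lact: "x \<in> bcarrier M \<Longrightarrow> (a * b) \<rhd> x = a \<rhd> (b \<rhd> x)"
    and mult_ract: "x \<in> bcarrier M \<Longrightarrow> x \<lhd> (a * b) = (x \<lhd> a) \<lhd> b"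
    and lact_ract: "x \<in> bcarrier M \<Longrightarrow> (a \<rhd> x) \<lhd> b = a \<rhd> (x \<lhd> b)"
    and lact_bounded: "\<exists>C. \<forall>a. \<forall>x\<in>bcarrier M. bnorm M (a \<rhd> x) \<le> C * norm a * bnorm M x"
    and ract_bounded: "\<exists>C. \<forall>a. \<forall>x\<in>bcarrier M. bnorm M (x \<lhd> a) \<le> C * norm a * bnorm M x"


section \<open>Derivations and bounded approximate contractibility\<close>

definition continuous_derivation ::
  "('k::ring_1 \<Rightarrow> 'a::real_normed_algebra \<Rightarrow> 'a) \<Rightarrow> ('k, 'a, 'x) bimod \<Rightarrow> ('a \<Rightarrow> 'x) \<Rightarrow> bool"
  where "continuous_derivation scl M D \<longleftrightarrow>
    range D \<subseteq> bcarrier M \<and>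
    (\<forall>a b. D (a + b) = badd M (D a) (D b)) \<and>
    (\<forall>c a. D (scl c a) = bscale M c (D a)) \<and>
    (\<forall>a b. D (a * b) = badd M (lact M a (D b)) (ract M (D a) b)) \<and>
    (\<exists>C. \<forall>a. bnorm M (D a) \<le> C * norm a)"

definition inner_derivation :: "('k::ring_1, 'a, 'x) bimod \<Rightarrow> ('a \<Rightarrow> 'x) \<Rightarrow> bool"
  where "inner_derivation M T \<longleftrightarrow>
    (\<exists>x\<in>bcarrier M. \<forall>a. T a = bdiff M (lact M a x) (ract M x a))"

text \<open>
  Nets are rendered as proper filters (on the set of operators, resp. on the algebra): a net yields
  the filter generated by its tails, and a proper filter \<open>F\<close> yields the net of all pairs \<open>(S, t)\<close>
  with \<open>t \<in> S\<close> and \<open>S\<close> in \<open>F\<close>, directed by reverse inclusion of the first component.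
\<close>

definition boundedly_approximable ::
  "('k::ring_1, 'a::real_normed_algebra, 'x) bimod \<Rightarrow> ('a \<Rightarrow> 'x) \<Rightarrow> bool"
  where "boundedly_approximable M D \<longleftrightarrow>
    (\<exists>(F :: ('a \<Rightarrow> 'x) filter) K. F \<noteq> bot \<and>
       (\<forall>\<^sub>F T in F. inner_derivation M T \<and> (\<forall>a. bnorm M (T a) \<le> K * norm a)) \<and>
       (\<forall>a. ((\<lambda>T. bnorm M (bdiff M (T a) (D a))) \<longlongrightarrow> 0) F))"

definition boundedly_approx_contractible_on ::
  "'x itself \<Rightarrow> ('k::{real_normed_field,banach} \<Rightarrow> 'a::{real_normed_algebra,banach} \<Rightarrow> 'a) \<Rightarrow> bool"
  where "boundedly_approx_contractible_on (_ :: 'x itself) scl \<longleftrightarrow>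
    (\<forall>(M :: ('k, 'a, 'x) bimod) D.
       banach_bimodule scl M \<longrightarrow> continuous_derivation scl M D \<longrightarrow> boundedly_approximable M D)"

text \<open>
  A formula cannot quantify over types, so the bimodules range over those whose carrier is a subset
  of one fixed type. Nothing is lost: the closed sub-bimodule generated by the range of a derivation
  embeds into \<open>nat \<Rightarrow> 'a list\<close>, so the property holds for bimodules over every type. This is
  \<open>boundedly_approx_contractible_all_types\<close> below.
\<close>

definition boundedly_approx_contractible ::
  "('k::{real_normed_field,banach} \<Rightarrow> 'a::{real_normed_algebra,banach} \<Rightarrow> 'a) \<Rightarrow> bool"
  where "boundedly_approx_contractible scl \<longleftrightarrow>
    boundedly_approx_contractible_on TYPE(nat \<Rightarrow> 'a list) scl"

definition has_bounded_approximate_identity :: "'a::real_normed_algebra itself \<Rightarrow> bool"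
  where "has_bounded_approximate_identity (_ :: 'a itself) \<longleftrightarrow>
    (\<exists>(F :: 'a filter) K. F \<noteq> bot \<and> (\<forall>\<^sub>F e in F. norm e \<le> K) \<and>
       (\<forall>a. ((\<lambda>e. e * a) \<longlongrightarrow> a) F) \<and> (\<forall>a. ((\<lambda>e. a * e) \<longlongrightarrow> a) F))"


section \<open>Independence of the carrier type\<close>

lemma list_induct3_step [case_names step nil one two]:
  assumes "\<And>a b c w. P w \<Longrightarrow> P (a # b # c # w)" "P []" "\<And>a. P [a]" "\<And>a b. P [a, b]"
  shows "P w"
proof (induction w rule: length_induct)
  case (1 w)
  consider "w = []" | a where "w = [a]" | a b where "w = [a, b]" | a b c v where "w = a # b # c # v"
    by (metis list.exhaust)
  then show ?case
  proof cases
    case 4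
    then have "length v < length w" by simp
    then show ?thesis using 1 assms(1) 4 by blast
  qed (simp_all add: assms(2-4))
qed

context banach_bimodule
begin

lemmas mem = zero_in add_in scale_in lact_in ract_in

lemma diff_in: "\<lbrakk>x \<in> bcarrier M; y \<in> bcarrier M\<rbrakk> \<Longrightarrow> x \<boxminus> y \<in> bcarrier M"
  by (simp add: bdiff_def mem)

lemma add_left_commute':
  "\<lbrakk>x \<in> bcarrier M; y \<in> bcarrier M; z \<in> bcarrier M\<rbrakk> \<Longrightarrow> x \<boxplus> (y \<boxplus> z) = y \<boxplus> (x \<boxplus> z)"
  by (metis add_assoc' add_commute')

lemma add_zero': "x \<in> bcarrier M \<Longrightarrow> x \<boxplus> \<zero> = x"
  by (metis add_commute' zero_add' zero_in)

lemmas ac = add_assoc' add_commute' add_left_commute'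

lemma zero_scale: assumes "x \<in> bcarrier M" shows "0 \<odot> x = \<zero>"
proof -
  have "bnorm M (0 \<odot> x) = 0" using assms by (simp add: norm_scale')
  thus ?thesis using assms norm_eq_zero' scale_in by blast
qed

lemma diff_self: assumes "x \<in> bcarrier M" shows "x \<boxminus> x = \<zero>"
proof -
  have "x \<boxminus> x = 1 \<odot> x \<boxplus> (-1) \<odot> x" using assms by (simp add: bdiff_def one_scale')
  also have "\<dots> = (1 + - 1) \<odot> x" using assms by (simp only: add_scale')
  also have "\<dots> = \<zero>" using assms by (simp add: zero_scale)
  finally show ?thesis .
qed

lemma cancel:
  assumes "x \<in> bcarrier M" "y \<in> bcarrier M" shows "y \<boxplus> (x \<boxminus> y) = x"
proof -
  have "y \<boxplus> (x \<boxminus> y) = x \<boxplus> (y \<boxminus> y)"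
    using assms by (simp add: bdiff_def ac mem)
  thus ?thesis using assms by (simp add: diff_self add_zero' mem)
qed

lemma diff_eq_zeroD:
  assumes "x \<in> bcarrier M" "y \<in> bcarrier M" "x \<boxminus> y = \<zero>" shows "x = y"
  using cancel[OF assms(1,2)] assms by (simp add: add_zero' mem)

lemma norm_nonneg: assumes "x \<in> bcarrier M" shows "0 \<le> bnorm M x"
proof -
  have "0 = bnorm M (x \<boxminus> x)" using assms by (simp add: diff_self norm_eq_zero' mem)
  also have "\<dots> \<le> bnorm M x + bnorm M ((-1) \<odot> x)"
    using assms unfolding bdiff_def by (intro norm_triangle' mem)
  also have "\<dots> = 2 * bnorm M x" using assms by (simp add: norm_scale')
  finally show ?thesis by simp
qed

lemma diff_swap:
  assumes "x \<in> bcarrier M" "y \<in> bcarrier M" shows "x \<boxminus> y = (-1) \<odot> (y \<boxminus> x)"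
  using assms by (simp add: bdiff_def scale_add' scale_scale' one_scale' mem add_commute')

lemma norm_diff_commute:
  assumes "x \<in> bcarrier M" "y \<in> bcarrier M" shows "bnorm M (x \<boxminus> y) = bnorm M (y \<boxminus> x)"
  using assms by (subst diff_swap) (simp_all add: norm_scale' diff_in)

lemma diff_diff:
  assumes "x \<in> bcarrier M" "y \<in> bcarrier M" "z \<in> bcarrier M"
  shows "(x \<boxminus> y) \<boxplus> (y \<boxminus> z) = x \<boxminus> z"
proof -
  have "(x \<boxminus> y) \<boxplus> (y \<boxminus> z) = (x \<boxminus> z) \<boxplus> (y \<boxminus> y)"
    using assms by (simp add: bdiff_def ac mem)
  thus ?thesis using assms by (simp add: diff_self diff_in add_zero' mem)
qed

lemma norm_diff_triangle:
  assumes "x \<in> bcarrier M" "y \<in> bcarrier M" "z \<in> bcarrier M"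
  shows "bnorm M (x \<boxminus> z) \<le> bnorm M (x \<boxminus> y) + bnorm M (y \<boxminus> z)"
  using norm_triangle'[OF diff_in diff_in, of x y y z] assms by (simp add: diff_diff)

lemma add_diff_add:
  assumes "x \<in> bcarrier M" "y \<in> bcarrier M" "x' \<in> bcarrier M" "y' \<in> bcarrier M"
  shows "(x \<boxplus> x') \<boxminus> (y \<boxplus> y') = (x \<boxminus> y) \<boxplus> (x' \<boxminus> y')"
  using assms by (simp add: bdiff_def ac mem scale_add')

lemma scale_diff:
  "\<lbrakk>x \<in> bcarrier M; y \<in> bcarrier M\<rbrakk> \<Longrightarrow> c \<odot> x \<boxminus> c \<odot> y = c \<odot> (x \<boxminus> y)"
  by (simp add: bdiff_def mem scale_add' scale_scale' mult.commute)

lemma lact_diff: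
  "\<lbrakk>x \<in> bcarrier M; y \<in> bcarrier M\<rbrakk> \<Longrightarrow> a \<rhd> x \<boxminus> a \<rhd> y = a \<rhd> (x \<boxminus> y)"
  by (simp add: bdiff_def mem lact_add lact_scale)

lemma ract_diff:
  "\<lbrakk>x \<in> bcarrier M; y \<in> bcarrier M\<rbrakk> \<Longrightarrow> x \<lhd> a \<boxminus> y \<lhd> a = (x \<boxminus> y) \<lhd> a"
  by (simp add: bdiff_def mem ract_add ract_scale)

text \<open>The closure of a subset of the carrier.\<close>

definition clos :: "'x set \<Rightarrow> 'x set"
  where "clos Z = {y \<in> bcarrier M. \<exists>z. range z \<subseteq> Z \<and> (\<lambda>n::nat. bnorm M (z n \<boxminus> y)) \<longlonglongrightarrow> 0}"

lemma clos_unary: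
  assumes y: "y \<in> clos Z" and Z: "Z \<subseteq> bcarrier M"
    and f: "\<And>x. x \<in> Z \<Longrightarrow> f x \<in> Z" "\<And>x. x \<in> bcarrier M \<Longrightarrow> f x \<in> bcarrier M"
    and bd: "\<And>x y. \<lbrakk>x \<in> bcarrier M; y \<in> bcarrier M\<rbrakk> \<Longrightarrow> bnorm M (f x \<boxminus> f y) \<le> C * bnorm M (x \<boxminus> y)"
  shows "f y \<in> clos Z"
proof -
  from y obtain z where z: "range z \<subseteq> Z" "(\<lambda>n::nat. bnorm M (z n \<boxminus> y)) \<longlonglongrightarrow> 0"
    and yM: "y \<in> bcarrier M" by (auto simp: clos_def)
  have zM: "z n \<in> bcarrier M" for n using z(1) Z by auto
  have "(\<lambda>n. bnorm M (f (z n) \<boxminus> f y)) \<longlonglongrightarrow> 0"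
  proof (rule tendsto_sandwich[of "\<lambda>_. 0" _ _ "\<lambda>n. C * bnorm M (z n \<boxminus> y)"])
    show "\<forall>\<^sub>F n in sequentially. 0 \<le> bnorm M (f (z n) \<boxminus> f y)"
      using zM yM f(2) by (simp add: norm_nonneg diff_in)
    show "\<forall>\<^sub>F n in sequentially. bnorm M (f (z n) \<boxminus> f y) \<le> C * bnorm M (z n \<boxminus> y)"
      using zM yM bd by simp
    show "(\<lambda>n. C * bnorm M (z n \<boxminus> y)) \<longlonglongrightarrow> 0" using tendsto_mult_left[OF z(2), of C] by simp
  qed simp
  moreover have "range (\<lambda>n. f (z n)) \<subseteq> Z" using z(1) f(1) by auto
  ultimately show ?thesis
    using f(2)[OF yM] by (auto simp: clos_def intro!: exI[of _ "\<lambda>n. f (z n)"])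
qed

lemma clos_add:
  assumes x: "x \<in> clos Z" and y: "y \<in> clos Z" and Z: "Z \<subseteq> bcarrier M"
    and add: "\<And>x y. \<lbrakk>x \<in> Z; y \<in> Z\<rbrakk> \<Longrightarrow> x \<boxplus> y \<in> Z"
  shows "x \<boxplus> y \<in> clos Z"
proof -
  from x obtain u where u: "range u \<subseteq> Z" "(\<lambda>n::nat. bnorm M (u n \<boxminus> x)) \<longlonglongrightarrow> 0"
    and xM: "x \<in> bcarrier M" by (auto simp: clos_def)
  from y obtain v where v: "range v \<subseteq> Z" "(\<lambda>n::nat. bnorm M (v n \<boxminus> y)) \<longlonglongrightarrow> 0"
    and yM: "y \<in> bcarrier M" by (auto simp: clos_def)
  have uM: "u n \<in> bcarrier M" and vM: "v n \<in> bcarrier M" for n using u(1) v(1) Z by auto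
  have "(\<lambda>n. bnorm M ((u n \<boxplus> v n) \<boxminus> (x \<boxplus> y))) \<longlonglongrightarrow> 0"
  proof (rule tendsto_sandwich[of "\<lambda>_. 0" _ _ "\<lambda>n. bnorm M (u n \<boxminus> x) + bnorm M (v n \<boxminus> y)"])
    show "\<forall>\<^sub>F n in sequentially. 0 \<le> bnorm M ((u n \<boxplus> v n) \<boxminus> (x \<boxplus> y))"
      using uM vM xM yM by (simp add: norm_nonneg diff_in mem)
    show "\<forall>\<^sub>F n in sequentially. bnorm M ((u n \<boxplus> v n) \<boxminus> (x \<boxplus> y))
        \<le> bnorm M (u n \<boxminus> x) + bnorm M (v n \<boxminus> y)"
      using uM vM xM yM by (simp add: add_diff_add norm_triangle' diff_in)
    show "(\<lambda>n. bnorm M (u n \<boxminus> x) + bnorm M (v n \<boxminus> y)) \<longlonglongrightarrow> 0"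
      using tendsto_add[OF u(2) v(2)] by simp
  qed simp
  moreover have "range (\<lambda>n. u n \<boxplus> v n) \<subseteq> Z" using u(1) v(1) add by auto
  ultimately show ?thesis
    using xM yM by (auto simp: clos_def mem intro!: exI[of _ "\<lambda>n. u n \<boxplus> v n"])
qed

lemma subset_clos: assumes "Z \<subseteq> bcarrier M" shows "Z \<subseteq> clos Z"
proof
  fix x assume "x \<in> Z"
  moreover have "bnorm M (x \<boxminus> x) = 0"
    using \<open>x \<in> Z\<close> assms by (simp add: subset_iff diff_self norm_eq_zero' mem)
  ultimately show "x \<in> clos Z"
    using assms by (auto simp: clos_def intro!: exI[of _ "\<lambda>_. x"])
qed

lemma clos_closed:
  assumes s: "range s \<subseteq> clos Z" and Z: "Z \<subseteq> bcarrier M" and l: "l \<in> bcarrier M"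
    and lim: "(\<lambda>n::nat. bnorm M (s n \<boxminus> l)) \<longlonglongrightarrow> 0"
  shows "l \<in> clos Z"
proof -
  have sM: "s n \<in> bcarrier M" for n using s by (auto simp: clos_def)
  have "\<exists>z\<in>Z. bnorm M (z \<boxminus> s n) < inverse (real (Suc n))" for n
  proof -
    have "s n \<in> clos Z" using s by auto
    then obtain z where z: "range z \<subseteq> Z" "(\<lambda>k::nat. bnorm M (z k \<boxminus> s n)) \<longlonglongrightarrow> 0"
      by (auto simp: clos_def)
    have "\<forall>\<^sub>F k in sequentially. bnorm M (z k \<boxminus> s n) < inverse (real (Suc n))"
      using z(2) by (rule order_tendstoD) simp
    then obtain k where "bnorm M (z k \<boxminus> s n) < inverse (real (Suc n))"
      by (auto simp: eventually_sequentially)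
    thus ?thesis using z(1) by auto
  qed
  then obtain w where w: "\<And>n. w n \<in> Z" "\<And>n. bnorm M (w n \<boxminus> s n) < inverse (real (Suc n))"
    by metis
  have wM: "w n \<in> bcarrier M" for n using w(1) Z by auto
  have "(\<lambda>n. bnorm M (w n \<boxminus> l)) \<longlonglongrightarrow> 0"
  proof (rule tendsto_sandwich[of "\<lambda>_. 0" _ _ "\<lambda>n. inverse (real (Suc n)) + bnorm M (s n \<boxminus> l)"])
    show "\<forall>\<^sub>F n in sequentially. 0 \<le> bnorm M (w n \<boxminus> l)"
      using wM l by (simp add: norm_nonneg diff_in)
    have "bnorm M (w n \<boxminus> l) \<le> inverse (real (Suc n)) + bnorm M (s n \<boxminus> l)" for n
      using norm_diff_triangle[OF wM sM l, of n n] w(2)[of n] by simp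
    thus "\<forall>\<^sub>F n in sequentially. bnorm M (w n \<boxminus> l) \<le> inverse (real (Suc n)) + bnorm M (s n \<boxminus> l)"
      by simp
    show "(\<lambda>n. inverse (real (Suc n)) + bnorm M (s n \<boxminus> l)) \<longlonglongrightarrow> 0"
      using tendsto_add[OF LIMSEQ_inverse_real_of_nat lim] by simp
  qed simp
  thus ?thesis using w(1) l by (auto simp: clos_def intro!: exI[of _ w])
qed

lemma closed_sub_bimodule:
  assumes Y: "Y \<subseteq> bcarrier M" "\<zero> \<in> Y"
    and ops: "\<And>x y. \<lbrakk>x \<in> Y; y \<in> Y\<rbrakk> \<Longrightarrow> x \<boxplus> y \<in> Y" "\<And>c x. x \<in> Y \<Longrightarrow> c \<odot> x \<in> Y"
      "\<And>a x. x \<in> Y \<Longrightarrow> a \<rhd> x \<in> Y" "\<And>a x. x \<in> Y \<Longrightarrow> x \<lhd> a \<in> Y"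
    and closed: "\<And>s l. \<lbrakk>range s \<subseteq> Y; l \<in> bcarrier M; (\<lambda>n::nat. bnorm M (s n \<boxminus> l)) \<longlonglongrightarrow> 0\<rbrakk> \<Longrightarrow> l \<in> Y"
  shows "banach_bimodule scl (M\<lparr>bcarrier := Y\<rparr>)"
proof -
  have YM: "x \<in> bcarrier M" if "x \<in> Y" for x using that Y by auto
  have dif: "bdiff (M\<lparr>bcarrier := Y\<rparr>) = bdiff M" by (intro ext) (simp add: bdiff_def)
  show ?thesis
  proof (unfold_locales, goal_cases)
    case (14 s)
    then have "range s \<subseteq> bcarrier M" using Y by auto
    then obtain l where "l \<in> bcarrier M" "(\<lambda>n. bnorm M (s n \<boxminus> l)) \<longlonglongrightarrow> 0"
      using complete'[of s] 14 by (auto simp: dif)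
    thus ?case using closed[of s l] 14 by (auto simp: dif)
  next
    case 28 thus ?case using lact_bounded YM by simp blast
  next
    case 29 thus ?case using ract_bounded YM by simp blast
  qed (use Y ops YM in \<open>auto simp: zero_add' scale_add' add_scale' scale_scale' one_scale'
      norm_eq_zero' norm_scale' norm_triangle' lact_add ract_add add_lact add_ract lact_scale
      ract_scale scale_lact scale_ract mult_lact mult_ract lact_ract ac add_zero'\<close>)
qed


text \<open>The sub-bimodule generated by the range of a derivation is the range of \<open>val D\<close>.\<close>

fun val :: "('a \<Rightarrow> 'x) \<Rightarrow> 'a list \<Rightarrow> 'x" where
  "val D (a # b # c # w) = a \<rhd> D b \<boxplus> (D c \<boxplus> val D w)"
| "val D _ = \<zero>"

lemma embeds:
  assumes D: "continuous_derivation scl M D"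
  obtains Y and f :: "'x \<Rightarrow> nat \<Rightarrow> 'a list" where
    "range D \<subseteq> Y" "Y \<subseteq> bcarrier M" "banach_bimodule scl (M\<lparr>bcarrier := Y\<rparr>)" "inj_on f Y"
proof -
  have DM: "D a \<in> bcarrier M" for a using D by (auto simp: continuous_derivation_def)
  have D_add: "D (a + b) = D a \<boxplus> D b" and D_scale: "D (scl c a) = c \<odot> D a"
    and D_mult: "D (a * b) = a \<rhd> D b \<boxplus> D a \<lhd> b" for a b c
    using D by (auto simp: continuous_derivation_def)
  have scl_minus: "scl (- 1) a = - a" for a using scale_of_real[of "-1" a] by simp
  have scl_zero: "scl 0 a = 0" for a using scale_of_real[of 0 a] by simp
  have D_zero: "D 0 = \<zero>" using D_scale[of 0 0] scl_zero DM by (simp add: zero_scale)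
  have zero_lact: "0 \<rhd> x = \<zero>" if "x \<in> bcarrier M" for x
    using scale_lact[of x 0 0] scl_zero that by (simp add: zero_scale mem)
  have scale_zero: "c \<odot> \<zero> = \<zero>" for c
    by (metis DM mult_zero_right scale_scale' zero_scale)
  have lact_zero: "a \<rhd> \<zero> = \<zero>" for a
    by (metis DM lact_in lact_scale zero_scale)
  have ract_zero: "\<zero> \<lhd> a = \<zero>" for a
    by (metis DM ract_in ract_scale zero_scale)
  have D_ract: "D a \<lhd> b = (- a) \<rhd> D b \<boxplus> D (a * b)" for a b
  proof -
    have "(- a) \<rhd> D b = (- 1) \<odot> (a \<rhd> D b)"
      using scale_lact[of "D b" "- 1" a] DM by (simp add: scl_minus)
    hence "(- a) \<rhd> D b \<boxplus> D (a * b) = D a \<lhd> b \<boxplus> (a \<rhd> D b \<boxminus> a \<rhd> D b)"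
      using DM by (simp add: D_mult bdiff_def ac mem)
    thus ?thesis using DM by (simp add: diff_self mem add_zero')
  qed
  have val_in: "val D w \<in> bcarrier M" for w
    by (induction w rule: list_induct3_step) (auto simp: mem DM)
  have val_eq: "a \<rhd> D b \<boxplus> (D c \<boxplus> val D w) \<in> range (val D)" for a b c w
    using rangeI[of "val D" "a # b # c # w"] by simp
  have val_short: "\<zero> \<in> range (val D)" using rangeI[of "val D" "[]"] by simp
  have val_add: "val D u \<boxplus> val D v \<in> range (val D)" for u v
  proof (induction u rule: list_induct3_step)
    case (step a b c u)
    then obtain w where "val D u \<boxplus> val D v = val D w" by auto
    hence "val D (a # b # c # u) \<boxplus> val D v = a \<rhd> D b \<boxplus> (D c \<boxplus> val D w)"
      by (simp add: add_assoc' mem DM val_in)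
    thus ?case by (simp add: val_eq)
  qed (simp_all add: zero_add' val_in)
  have val_scale: "k \<odot> val D u \<in> range (val D)" for k u
  proof (induction u rule: list_induct3_step)
    case (step a b c u)
    then obtain w where "k \<odot> val D u = val D w" by auto
    hence "k \<odot> val D (a # b # c # u) = scl k a \<rhd> D b \<boxplus> (D (scl k c) \<boxplus> val D w)"
      by (simp add: scale_add' scale_lact D_scale mem DM val_in)
    thus ?case by (simp add: val_eq)
  qed (simp_all add: scale_zero val_short)
  have val_lact: "d \<rhd> val D u \<in> range (val D)" for d u
  proof (induction u rule: list_induct3_step)
    case (step a b c u)
    then obtain w where "d \<rhd> val D u = val D w" by auto
    hence "d \<rhd> val D (a # b # c # u) = (d * a) \<rhd> D b \<boxplus> (D 0 \<boxplus> val D (d # c # 0 # w))"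
      by (simp add: lact_add mult_lact D_zero zero_add' mem DM val_in)
    thus ?case by (simp only: val_eq)
  qed (simp_all add: lact_zero val_short)
  have val_ract: "val D u \<lhd> d \<in> range (val D)" for d u
  proof (induction u rule: list_induct3_step)
    case (step a b c u)
    then obtain w where w: "val D u \<lhd> d = val D w" by auto
    have "(a \<rhd> D b) \<lhd> d = (- (a * b)) \<rhd> D d \<boxplus> a \<rhd> D (b * d)"
      using DM mult_lact[of "D d" a "- b"] by (simp add: lact_ract D_ract lact_add mem)
    with w have "val D (a # b # c # u) \<lhd> d
        = (- (a * b)) \<rhd> D d \<boxplus> (D 0 \<boxplus> val D (a # (b * d) # 0 # (- c) # d # (c * d) # w))"
      by (simp add: ract_add D_ract D_zero zero_add' add_assoc' mem DM val_in)
    thus ?case by (simp only: val_eq)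
  qed (simp_all add: ract_zero val_short)
  define Z where "Z = range (val D)"
  have ZM: "Z \<subseteq> bcarrier M" using val_in by (auto simp: Z_def)
  have DZ: "D a \<in> Z" for a
    using val_eq[of 0 0 a "[]"] DM
    by (simp add: Z_def zero_lact zero_add' mem add_zero')
  obtain C where C: "\<And>a x. x \<in> bcarrier M \<Longrightarrow> bnorm M (a \<rhd> x) \<le> C * norm a * bnorm M x"
    using lact_bounded by blast
  obtain C' where C': "\<And>a x. x \<in> bcarrier M \<Longrightarrow> bnorm M (x \<lhd> a) \<le> C' * norm a * bnorm M x"
    using ract_bounded by blast
  have "banach_bimodule scl (M\<lparr>bcarrier := clos Z\<rparr>)"
  proof (rule closed_sub_bimodule)
    show "clos Z \<subseteq> bcarrier M" by (auto simp: clos_def)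
    show "\<zero> \<in> clos Z" using val_short subset_clos[OF ZM] by (auto simp: Z_def)
    show "x \<boxplus> y \<in> clos Z" if "x \<in> clos Z" "y \<in> clos Z" for x y
      using that ZM by (rule clos_add) (auto simp: Z_def val_add)
    show "c \<odot> x \<in> clos Z" if "x \<in> clos Z" for c x
      using that ZM by (rule clos_unary[where C = "norm c"])
        (auto simp: Z_def val_scale mem scale_diff norm_scale' diff_in)
    show "a \<rhd> x \<in> clos Z" if "x \<in> clos Z" for a x
      using that ZM by (rule clos_unary[where C = "C * norm a"])
        (auto simp: Z_def val_lact mem lact_diff C diff_in)
    show "x \<lhd> a \<in> clos Z" if "x \<in> clos Z" for a x
      using that ZM by (rule clos_unary[where C = "C' * norm a"])
        (auto simp: Z_def val_ract mem ract_diff C' diff_in)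
    show "l \<in> clos Z" if "range s \<subseteq> clos Z" "l \<in> bcarrier M"
      "(\<lambda>n::nat. bnorm M (s n \<boxminus> l)) \<longlonglongrightarrow> 0" for s l
      using that ZM by (intro clos_closed)
  qed
  moreover
  define conv where "conv = (\<lambda>s y. (\<lambda>n::nat. bnorm M (val D (s n) \<boxminus> y)) \<longlonglongrightarrow> 0)"
  have "\<exists>s. conv s y" if "y \<in> clos Z" for y
  proof -
    from that obtain z where z: "range z \<subseteq> Z" "(\<lambda>n::nat. bnorm M (z n \<boxminus> y)) \<longlonglongrightarrow> 0"
      by (auto simp: clos_def)
    from z(1) have "\<forall>n. \<exists>w. z n = val D w" by (auto simp: Z_def)
    then obtain s where "\<And>n. z n = val D (s n)" by metis
    thus ?thesis using z(2) by (auto simp: conv_def)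
  qed
  then obtain f where f: "\<And>y. y \<in> clos Z \<Longrightarrow> conv (f y) y" by metis
  have "inj_on f (clos Z)"
  proof (rule inj_onI)
    fix x y assume xy: "x \<in> clos Z" "y \<in> clos Z" "f x = f y"
    then have M: "x \<in> bcarrier M" "y \<in> bcarrier M" by (auto simp: clos_def)
    have "(\<lambda>n. bnorm M (val D (f x n) \<boxminus> x) + bnorm M (val D (f x n) \<boxminus> y)) \<longlonglongrightarrow> 0 + 0"
      using f[OF xy(1)] f[OF xy(2)] xy(3) unfolding conv_def by (intro tendsto_add) simp_all
    moreover have "bnorm M (x \<boxminus> y) \<le> bnorm M (val D (f x n) \<boxminus> x) + bnorm M (val D (f x n) \<boxminus> y)" for n
      using norm_diff_triangle[of x "val D (f x n)" y] norm_diff_commute[of x "val D (f x n)"] M val_in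
      by simp
    ultimately have "bnorm M (x \<boxminus> y) \<le> 0 + 0" by (intro LIMSEQ_le_const) auto
    hence "bnorm M (x \<boxminus> y) = 0" using norm_nonneg[OF diff_in[OF M]] by simp
    hence "x \<boxminus> y = \<zero>" using norm_eq_zero'[OF diff_in[OF M]] by simp
    thus "x = y" using M by (rule diff_eq_zeroD[rotated -1])
  qed
  moreover have "range D \<subseteq> clos Z" using DZ subset_clos[OF ZM] by auto
  moreover have "clos Z \<subseteq> bcarrier M" by (auto simp: clos_def)
  ultimately show ?thesis using that by blast
qed

end

definition transport :: "('x \<Rightarrow> 'y) \<Rightarrow> ('k, 'a, 'x) bimod \<Rightarrow> ('k, 'a, 'y) bimod"
  where "transport f M = (let g = inv_into (bcarrier M) f in
    \<lparr>bcarrier = f ` bcarrier M, badd = (\<lambda>u v. f (badd M (g u) (g v))), bzero = f (bzero M),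
     bscale = (\<lambda>c u. f (bscale M c (g u))), bnorm = (\<lambda>u. bnorm M (g u)),
     lact = (\<lambda>a u. f (lact M a (g u))), ract = (\<lambda>u a. f (ract M (g u) a))\<rparr>)"

context banach_bimodule
begin

context
  fixes f :: "'x \<Rightarrow> 'y" assumes inj: "inj_on f (bcarrier M)"
begin

lemma transport_simps:
  "bcarrier (transport f M) = f ` bcarrier M"
  "bzero (transport f M) = f \<zero>"
  "\<lbrakk>x \<in> bcarrier M; y \<in> bcarrier M\<rbrakk> \<Longrightarrow> badd (transport f M) (f x) (f y) = f (x \<boxplus> y)"
  "x \<in> bcarrier M \<Longrightarrow> bscale (transport f M) c (f x) = f (c \<odot> x)"
  "x \<in> bcarrier M \<Longrightarrow> bnorm (transport f M) (f x) = bnorm M x"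
  "x \<in> bcarrier M \<Longrightarrow> lact (transport f M) a (f x) = f (a \<rhd> x)"
  "x \<in> bcarrier M \<Longrightarrow> ract (transport f M) (f x) a = f (x \<lhd> a)"
  "\<lbrakk>x \<in> bcarrier M; y \<in> bcarrier M\<rbrakk> \<Longrightarrow> bdiff (transport f M) (f x) (f y) = f (x \<boxminus> y)"
  using inj by (simp_all add: transport_def Let_def bdiff_def mem)

lemma transport_bimodule: "banach_bimodule scl (transport f M)"
proof (unfold_locales, goal_cases)
  case (14 s)
  then have "\<forall>n. \<exists>x\<in>bcarrier M. s n = f x" by (force simp: transport_simps)
  then obtain r where r: "\<And>n. r n \<in> bcarrier M" "\<And>n. s n = f (r n)" by metis
  have "\<exists>l\<in>bcarrier M. (\<lambda>n. bnorm M (r n \<boxminus> l)) \<longlonglongrightarrow> 0"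
    using 14 r by (intro complete') (auto simp: transport_simps diff_in)
  thus ?case using r by (auto simp: transport_simps diff_in)
next
  case 28 thus ?case using lact_bounded by (auto simp: transport_simps mem)
next
  case 29 thus ?case using ract_bounded by (auto simp: transport_simps mem)
qed (use inj in \<open>auto simp: transport_simps mem zero_add' scale_add' add_scale' scale_scale' one_scale'
      norm_eq_zero' norm_scale' norm_triangle' lact_add ract_add add_lact add_ract lact_scale
      ract_scale scale_lact scale_ract mult_lact mult_ract lact_ract ac add_zero' inj_on_eq_iff\<close>)

lemma transport_derivation:
  assumes "continuous_derivation scl M D"
  shows "continuous_derivation scl (transport f M) (f \<circ> D)"
proof -
  have "D a \<in> bcarrier M" for a using assms by (auto simp: continuous_derivation_def)
  thus ?thesis using assms by (auto simp: continuous_derivation_def transport_simps mem)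
qed

lemma transport_approximable:
  assumes D: "continuous_derivation scl M D"
    and "boundedly_approximable (transport f M) (f \<circ> D)"
  shows "boundedly_approximable M D"
proof -
  have DM: "D a \<in> bcarrier M" for a using D by (auto simp: continuous_derivation_def)
  define g where "g = (\<lambda>T. inv_into (bcarrier M) f \<circ> (T :: 'a \<Rightarrow> 'y))"
  obtain F K where F: "F \<noteq> bot"
    and inner: "\<forall>\<^sub>F T in F. inner_derivation (transport f M) T \<and>
        (\<forall>a. bnorm (transport f M) (T a) \<le> K * norm a)"
    and lim: "\<And>a. ((\<lambda>T. bnorm (transport f M) (bdiff (transport f M) (T a) (f (D a)))) \<longlongrightarrow> 0) F"
    using assms(2) by (auto simp: boundedly_approximable_def)
  have g: "inner_derivation M (g T) \<and> (\<forall>a. g T a \<in> bcarrier M \<and> T a = f (g T a))"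
    if inn: "inner_derivation (transport f M) T" for T
  proof -
    from inn obtain x where x: "x \<in> bcarrier M" "\<And>a. T a = f (a \<rhd> x \<boxminus> x \<lhd> a)"
      by (auto simp: inner_derivation_def transport_simps mem)
    have "g T a = a \<rhd> x \<boxminus> x \<lhd> a" for a
      using x inj by (simp add: g_def mem diff_in)
    thus ?thesis using x by (auto simp: inner_derivation_def mem diff_in)
  qed
  have ev: "\<forall>\<^sub>F T in F. inner_derivation M (g T) \<and> (\<forall>a. bnorm M (g T a) \<le> K * norm a)"
    using inner
  proof eventually_elim
    case (elim T)
    have "bnorm (transport f M) (T a) = bnorm M (g T a)" for a
      using g[of T] elim transport_simps(5)[of "g T a"] by metis
    thus ?case using elim g by simp
  qed
  have lim': "((\<lambda>T. bnorm M (g T a \<boxminus> D a)) \<longlongrightarrow> 0) F" for a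
  proof (rule Lim_transform_eventually[OF lim[of a]])
    show "\<forall>\<^sub>F T in F. bnorm (transport f M) (bdiff (transport f M) (T a) (f (D a)))
        = bnorm M (g T a \<boxminus> D a)"
      using inner
    proof eventually_elim
      case (elim T)
      then have T: "g T a \<in> bcarrier M" "T a = f (g T a)" using g by blast+
      show ?case unfolding T(2) using T(1) DM[of a]
        by (simp add: transport_simps diff_in flip: T(2))
          (simp add: T(2) transport_simps diff_in)
    qed
  qed
  show ?thesis unfolding boundedly_approximable_def
  proof (intro exI[of _ "filtermap g F"] exI[of _ K] conjI allI)
    show "filtermap g F \<noteq> bot" using F by (simp add: filtermap_bot_iff)
    show "\<forall>\<^sub>F T in filtermap g F. inner_derivation M T \<and> (\<forall>a. bnorm M (T a) \<le> K * norm a)"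
      using ev by (simp add: eventually_filtermap)
    show "((\<lambda>T. bnorm M (T a \<boxminus> D a)) \<longlongrightarrow> 0) (filtermap g F)" for a
      using lim' by (simp add: filterlim_filtermap)
  qed
qed

end

end

theorem boundedly_approx_contractible_all_types:
  fixes scl :: "'k::{real_normed_field,banach} \<Rightarrow> 'a::{real_normed_algebra,banach} \<Rightarrow> 'a"
  assumes "boundedly_approx_contractible scl"
  shows "boundedly_approx_contractible_on TYPE('x) scl"
  unfolding boundedly_approx_contractible_on_def
proof (intro allI impI)
  fix M :: "('k, 'a, 'x) bimod" and D
  assume M: "banach_bimodule scl M" and D: "continuous_derivation scl M D"
  obtain Y and f :: "'x \<Rightarrow> nat \<Rightarrow> 'a list" where Y: "range D \<subseteq> Y" "Y \<subseteq> bcarrier M"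
    and N: "banach_bimodule scl (M\<lparr>bcarrier := Y\<rparr>)" and f: "inj_on f Y"
    using banach_bimodule.embeds[OF M D] by blast
  let ?N = "M\<lparr>bcarrier := Y\<rparr>"
  have f': "inj_on f (bcarrier ?N)" using f by simp
  have DN: "continuous_derivation scl ?N D"
    using D Y(1) by (simp add: continuous_derivation_def)
  have "boundedly_approximable (transport f ?N) (f \<circ> D)"
    using assms banach_bimodule.transport_bimodule[OF N f']
      banach_bimodule.transport_derivation[OF N f' DN]
    by (auto simp: boundedly_approx_contractible_def boundedly_approx_contractible_on_def)
  then have "boundedly_approximable ?N D"
    by (rule banach_bimodule.transport_approximable[OF N f' DN])
  moreover have "inner_derivation M T" if "inner_derivation ?N T" for T
    using that Y(2) by (auto simp: inner_derivation_def bdiff_def)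
  moreover have "bnorm ?N = bnorm M" "bdiff ?N = bdiff M"
    by (simp_all add: bdiff_def fun_eq_iff)
  ultimately have "inner_derivation M T \<and> P" if "inner_derivation ?N T \<and> P" for T P
    using that by blast
  with \<open>boundedly_approximable ?N D\<close> show "boundedly_approximable M D"
    unfolding boundedly_approximable_def \<open>bnorm ?N = bnorm M\<close> \<open>bdiff ?N = bdiff M\<close>
    by (elim exE conjE) (intro exI conjI, assumption, erule eventually_mono, blast, assumption)
qed

end

theory Submission
  imports Defs
begin

text \<open>
  Apply the hypothesis to the derivation \<open>a \<mapsto> a \<otimes> 1 - 1 \<otimes> a\<close> into the tensors over the unitization
  without \<open>1 \<otimes> 1\<close> component. The approximating inner derivations come from elements with components
  \<open>F \<otimes> 1\<close>, \<open>1 \<otimes> G\<close> and \<open>M \<in> A \<otimes> A\<close>; comparing components, \<open>F\<close> is a right and \<open>G\<close> a left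
  approximate identity, both are bounded as multipliers, and
  \<open>a \<otimes> G + a \<cdot> M - M \<cdot> a - F \<otimes> a\<close> has norm at most \<open>K \<parallel>a\<parallel>\<close>.

  Suppose that \<open>\<parallel>F\<parallel>\<close> tends to infinity along the net. Then the normalized elements
  \<open>f = F / \<parallel>F\<parallel>\<close> satisfy \<open>b f \<rightarrow> 0\<close> for all \<open>b\<close>. Fix an index \<open>i\<close>, then take \<open>l\<close> and then \<open>n\<close> far out in the
  net, and apply \<open>y \<mapsto> y - G\<^sub>l y\<close> to the second tensor factor of the above expression for
  \<open>a = f\<^sub>n\<close>. Every term but the last becomes bounded independently of \<open>i\<close>, and the last one is nearly
  \<open>F\<^sub>i \<otimes> f\<^sub>n\<close>, of norm about \<open>\<parallel>F\<^sub>i\<parallel>\<close>: a contradiction. The mirror image of this argument handles \<open>G\<close>.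
\<close>

section \<open>The Hahn-Banach theorem by way of minimal sublinear functionals\<close>

section \<open>Norming functionals\<close>

definition sublinear :: "('a::real_vector \<Rightarrow> real) \<Rightarrow> bool"
  where "sublinear p \<longleftrightarrow> (\<forall>x y. p (x + y) \<le> p x + p y) \<and> (\<forall>r\<ge>0. \<forall>x. p (r *\<^sub>R x) = r * p x)"

lemma sublinear_zero: "sublinear p \<Longrightarrow> p 0 = 0"
  unfolding sublinear_def by (metis order_refl scaleR_zero_left mult_zero_left)

lemma sublinear_ge: assumes "sublinear p" shows "- p (- x) \<le> p x"
proof -
  have "p (x + - x) \<le> p x + p (- x)" using assms unfolding sublinear_def by blast
  then show ?thesis using sublinear_zero[OF assms] by simp
qed

text \<open>Moving by \<open>t\<close> along \<open>y\<close> and then subtracting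
  \<open>t * p y\<close> gives a family whose infimum is again sublinear. The parameter
  \<open>t = 0\<close> yields \<open>q \<le> p\<close>, and \<open>t = 1\<close> at the point
  \<open>- y\<close> yields the last claim. Minimality will rule out that such a lowering is
  strict.\<close>

lemma sublinear_lowered:
  fixes y :: "'a::real_vector"
  assumes p: "sublinear p"
  obtains q where "sublinear q" "q \<le> p" "q (- y) \<le> - p y"
proof -
  define q where "q x = (INF t\<in>{0..}. p (x + t *\<^sub>R y) - t * p y)" for x
  have add: "p (x + z) \<le> p x + p z" for x z using p by (simp add: sublinear_def)
  have sc: "p (r *\<^sub>R x) = r * p x" if "0 \<le> r" for r x using p that by (simp add: sublinear_def)
  \<comment> \<open>A lower bound independent of \<open>t\<close> makes the infimum finite.\<close>
  have lb: "- p (- x) \<le> p (x + t *\<^sub>R y) - t * p y" if "0 \<le> t" for x t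
    using add[of "x + t *\<^sub>R y" "- x"] sc[OF that, of y] by simp
  have bdd: "bdd_below ((\<lambda>t. p (x + t *\<^sub>R y) - t * p y) ` {0..})" for x
    using lb[of _ x] by (intro bdd_belowI[of _ "- p (- x)"]) auto
  have upper: "q x \<le> p (x + t *\<^sub>R y) - t * p y" if "0 \<le> t" for x t
    unfolding q_def using that by (intro cINF_lower bdd) auto
  have greatest: "m \<le> q x" if "\<And>t. 0 \<le> t \<Longrightarrow> m \<le> p (x + t *\<^sub>R y) - t * p y" for m x
    unfolding q_def using that by (intro cINF_greatest) auto
  have q_add: "q (x + z) \<le> q x + q z" for x z
  proof -
    have "q (x + z) - (p (z + t *\<^sub>R y) - t * p y) \<le> q x" if t: "0 \<le> t" for t
    proof (rule greatest)
      fix s :: real assume s: "0 \<le> s"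
      have "q (x + z) \<le> p ((x + z) + (s + t) *\<^sub>R y) - (s + t) * p y" using s t by (intro upper) auto
      also have "p ((x + z) + (s + t) *\<^sub>R y) \<le> p (x + s *\<^sub>R y) + p (z + t *\<^sub>R y)"
        using add[of "x + s *\<^sub>R y" "z + t *\<^sub>R y"] by (simp add: algebra_simps)
      finally show "q (x + z) - (p (z + t *\<^sub>R y) - t * p y) \<le> p (x + s *\<^sub>R y) - s * p y"
        by (simp add: algebra_simps)
    qed
    then have "q (x + z) - q x \<le> q z" by (intro greatest) (simp add: algebra_simps)
    then show ?thesis by simp
  qed
  have q_le: "r * q x \<le> q (r *\<^sub>R x)" if r: "0 < r" for r x
  proof (rule greatest)
    fix t :: real assume t: "0 \<le> t"
    have "r * q x \<le> r * (p (x + (t / r) *\<^sub>R y) - (t / r) * p y)"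
      using r t by (intro mult_left_mono upper) auto
    also have "\<dots> = p (r *\<^sub>R (x + (t / r) *\<^sub>R y)) - t * p y"
      using r by (simp add: sc[of r] right_diff_distrib)
    also have "\<dots> = p (r *\<^sub>R x + t *\<^sub>R y) - t * p y"
      using r by (simp add: scaleR_right_distrib)
    finally show "r * q x \<le> p (r *\<^sub>R x + t *\<^sub>R y) - t * p y" .
  qed
  have "q 0 = 0"
  proof (rule antisym)
    show "q 0 \<le> 0" using upper[of 0 0] by (simp add: sublinear_zero[OF p])
    show "0 \<le> q 0" by (rule greatest) (simp add: sc)
  qed
  moreover have "q (r *\<^sub>R x) = r * q x" if r: "0 < r" for r x
  proof (rule antisym[OF _ q_le[OF r]])
    have "(1 / r) * q (r *\<^sub>R x) \<le> q ((1 / r) *\<^sub>R (r *\<^sub>R x))" using r by (intro q_le) auto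
    then show "q (r *\<^sub>R x) \<le> r * q x" using r by (simp add: field_simps)
  qed
  ultimately have "sublinear q"
    using q_add unfolding sublinear_def by (metis le_less mult_zero_left scaleR_zero_left)
  moreover have "q \<le> p" using upper[of 0] by (simp add: le_fun_def)
  moreover have "q (- y) \<le> - p y" using upper[of 1 "- y"] by (simp add: sublinear_zero[OF p])
  ultimately show ?thesis by (rule that)
qed

text \<open>Lowering along \<open>y\<close> cannot change a minimal functional, which forces
  \<open>q (- y) \<le> - q y\<close>; an odd sublinear functional is linear.\<close>

lemma minimal_sublinear_linear:
  assumes q: "sublinear q" and min: "\<And>r. sublinear r \<Longrightarrow> r \<le> q \<Longrightarrow> r = q"
  shows "linear q"
proof -
  have neg: "q (- y) = - q y" for y
  proof -
    obtain r where "sublinear r" "r \<le> q" "r (- y) \<le> - q y" by (rule sublinear_lowered[OF q])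
    with min[of r] have "q (- y) \<le> - q y" by blast
    then show ?thesis using sublinear_ge[OF q, of y] by simp
  qed
  have "q (x + y) = q x + q y" for x y
  proof -
    have "q (x + y) \<le> q x + q y" using q by (simp add: sublinear_def)
    moreover have "q x \<le> q (x + y) + q (- y)"
      using q unfolding sublinear_def by (metis add_diff_cancel_right' diff_conv_add_uminus)
    ultimately show ?thesis by (simp add: neg)
  qed
  moreover have "q (r *\<^sub>R x) = r *\<^sub>R q x" for r x
  proof (cases "0 \<le> r")
    case True then show ?thesis using q by (simp add: sublinear_def)
  next
    case False
    then have "0 \<le> - r" by simp
    then have "q ((- r) *\<^sub>R x) = (- r) * q x" using q unfolding sublinear_def by blast
    then show ?thesis using neg[of "r *\<^sub>R x"] by simp
  qed
  ultimately show ?thesis by (intro linearI)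
qed

text \<open>Zorn's lemma for the reversed pointwise order. The infimum of a chain stays above
  \<open>- p (- x)\<close>, and it is subadditive because any two members of the chain have a common
  minorant in it.\<close>

lemma minimal_sublinear_exists:
  fixes p :: "'a::real_vector \<Rightarrow> real"
  assumes p: "sublinear p"
  obtains q where "sublinear q" "q \<le> p" "\<And>r. sublinear r \<Longrightarrow> r \<le> q \<Longrightarrow> r = q"
proof -
  define A where "A = {q. sublinear q \<and> q \<le> p}"
  have "\<exists>m\<in>A. \<forall>a\<in>A. m \<ge> a \<longrightarrow> a = m"
  proof (rule predicate_Zorn)
    show "partial_order_on A (relation_of (\<ge>) A)"
      by (intro partial_order_on_relation_ofI) auto
    fix C assume C: "C \<in> Chains (relation_of (\<ge>) A)"
    then have CA: "C \<subseteq> A" and tot: "\<And>f g. f \<in> C \<Longrightarrow> g \<in> C \<Longrightarrow> f \<le> g \<or> g \<le> f"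
      by (auto simp: Chains_def relation_of_def)
    have sub: "sublinear f" "f x \<le> p x" if "f \<in> C" for f x
      using that CA by (auto simp: A_def le_fun_def)
    show "\<exists>u\<in>A. \<forall>a\<in>C. u \<le> a"
    proof (cases "C = {}")
      case True then show ?thesis using p by (intro bexI[of _ p]) (auto simp: A_def)
    next
      case False
      define u where "u x = (INF f\<in>C. f x)" for x
      have bdd: "bdd_below ((\<lambda>f. f x) ` C)" for x
      proof (intro bdd_belowI[of _ "- p (- x)"], clarify)
        fix f assume "f \<in> C"
        then show "- p (- x) \<le> f x"
          using sublinear_ge[OF sub(1), of f x] sub(2)[of f "- x"] by simp
      qed
      have upper: "u x \<le> f x" if "f \<in> C" for f x
        unfolding u_def by (intro cINF_lower bdd that)
      have greatest: "m \<le> u x" if "\<And>f. f \<in> C \<Longrightarrow> m \<le> f x" for m x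
        unfolding u_def using that False by (intro cINF_greatest) auto
      have mono: "\<exists>h\<in>C. h \<le> f \<and> h \<le> g" if "f \<in> C" "g \<in> C" for f g
        using tot[OF that] that by blast
      have "u (x + z) \<le> u x + u z" for x z
      proof -
        have "u (x + z) - g z \<le> u x" if g: "g \<in> C" for g
        proof (rule greatest)
          fix f assume "f \<in> C"
          then obtain h where h: "h \<in> C" "h \<le> f" "h \<le> g" using mono g by blast
          have "u (x + z) \<le> h (x + z)" by (rule upper[OF h(1)])
          also have "\<dots> \<le> h x + h z" using sub(1)[OF h(1)] by (simp add: sublinear_def)
          also have "\<dots> \<le> f x + g z" using h by (intro add_mono) (auto simp: le_fun_def)
          finally show "u (x + z) - g z \<le> f x" by simp
        qed
        then have "u (x + z) - u x \<le> u z" by (intro greatest) (simp add: algebra_simps)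
        then show ?thesis by simp
      qed
      moreover have "u (r *\<^sub>R x) = r * u x" if r: "0 \<le> r" for r x
      proof -
        have "(INF f\<in>C. f (r *\<^sub>R x)) = (INF f\<in>C. r * f x)"
          using sub(1) r by (intro INF_cong) (auto simp: sublinear_def)
        also have "\<dots> = r * (INF f\<in>C. f x)"
        proof (cases "r = 0")
          case True then show ?thesis using False by simp
        next
          case False
          with r have r: "0 < r" by simp
          show ?thesis
          proof (rule antisym)
            have "(INF f\<in>C. r * f x) / r \<le> u x"
            proof (rule greatest)
              fix f assume f: "f \<in> C"
              have "bdd_below ((\<lambda>f. r * f x) ` C)"
                using upper r by (intro bdd_belowI[of _ "r * u x"]) auto
              then have "(INF f\<in>C. r * f x) \<le> r * f x" by (rule cINF_lower[OF _ f])
              then show "(INF f\<in>C. r * f x) / r \<le> f x" using r by (simp add: field_simps)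
            qed
            then show "(INF f\<in>C. r * f x) \<le> r * (INF f\<in>C. f x)"
              using r by (simp add: field_simps u_def)
            show "r * (INF f\<in>C. f x) \<le> (INF f\<in>C. r * f x)"
              using upper r \<open>C \<noteq> {}\<close> by (intro cINF_greatest) (auto simp flip: u_def)
          qed
        qed
        finally show ?thesis by (simp add: u_def)
      qed
      ultimately have "sublinear u" by (simp add: sublinear_def)
      moreover have "u \<le> p"
      proof -
        obtain f where "f \<in> C" using False by blast
        then show ?thesis using upper sub(2) unfolding le_fun_def by (meson order_trans)
      qed
      ultimately show ?thesis using upper by (intro bexI[of _ u]) (auto simp: A_def le_fun_def)
    qed
  qed
  then obtain m where "m \<in> A" "\<And>a. a \<in> A \<Longrightarrow> a \<le> m \<Longrightarrow> a = m" by blast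
  then show ?thesis using that[of m] by (auto simp: A_def)
qed

text \<open>The norm is lowered along \<open>x\<close> before a minimal functional is taken below
  it: then \<open>q (- x) \<le> - norm x\<close>, and linearity turns this into
  \<open>norm x \<le> q x\<close>.\<close>

lemma norming_functional:
  fixes x :: "'a::real_normed_vector"
  obtains \<phi> :: "'a \<Rightarrow>\<^sub>L real" where "norm \<phi> \<le> 1" "\<phi> x = norm x"
proof -
  have "sublinear (norm :: 'a \<Rightarrow> real)" by (simp add: sublinear_def norm_triangle_ineq)
  then obtain p where p: "sublinear p" "p \<le> norm" "p (- x) \<le> - norm x"
    by (rule sublinear_lowered)
  obtain q where q: "sublinear q" "q \<le> p" "\<And>r. sublinear r \<Longrightarrow> r \<le> q \<Longrightarrow> r = q"
    using minimal_sublinear_exists[OF p(1)] by blast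
  have "linear q" using q(1,3) by (rule minimal_sublinear_linear)
  have le: "q z \<le> norm z" for z using q(2) p(2) by (meson le_fun_def order_trans)
  have abs: "\<bar>q z\<bar> \<le> norm z" for z
    using le[of z] le[of "- z"] linear_neg[OF \<open>linear q\<close>, of z] by simp
  then have "bounded_linear q"
    using \<open>linear q\<close> by (intro bounded_linear_intro[where K = 1]) (auto simp: linear_add linear_cmul)
  then have app: "blinfun_apply (Blinfun q) = q" by (rule bounded_linear_Blinfun_apply)
  have "q x = norm x"
    using le[of x] q(2) p(3) linear_neg[OF \<open>linear q\<close>, of x] by (smt (verit) le_fun_def)
  moreover have "norm (Blinfun q) \<le> 1" using abs by (intro norm_blinfun_bound) (auto simp: app)
  ultimately show ?thesis using that[of "Blinfun q"] by (simp add: app)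
qed

section \<open>A Gelfand-Mazur theorem for commutative real normed fields\<close>

section \<open>Real normed fields\<close>

text \<open>
  Pairs \<open>(a, b)\<close> stand for \<open>a + b \<i>\<close> over the field, with the multiplicative form \<open>a\<^sup>2 + b\<^sup>2\<close>;
  \<open>gsqr k\<close> is the \<open>2\<^sup>k\<close>-th power.
\<close>

fun gsqr :: "nat \<Rightarrow> 'r::comm_ring_1 \<times> 'r \<Rightarrow> 'r \<times> 'r" where
  "gsqr 0 w = w"
| "gsqr (Suc k) w = (let (a, b) = gsqr k w in (a\<^sup>2 - b\<^sup>2, 2 * a * b))"

lemma real_gaussian_sqrt: obtains s t :: real where "s\<^sup>2 - t\<^sup>2 = u" "2 * s * t = v"
proof -
  define z where "z = csqrt (Complex u v)"
  have "z\<^sup>2 = Complex u v" by (simp add: z_def)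
  then have "Re (z\<^sup>2) = u" "Im (z\<^sup>2) = v" by simp_all
  then show ?thesis using that[of "Re z" "Im z"] by (simp add: power2_eq_square mult.commute)
qed

lemma power_double_exponent: "x ^ 2 ^ Suc k = x ^ 2 ^ k * (x ^ 2 ^ k :: 'b::monoid_mult)"
  by (simp only: power_Suc mult_2 power_add)

text \<open>A real pair has a real square root \<open>c\<close>, so the square of a pair
  \<open>p\<close> minus that real pair factors into \<open>p - c\<close> and \<open>p + c\<close>.
  The form is multiplicative and both factors obey the induction hypothesis, so squaring
  \<open>p\<close> squares the lower bound.\<close>

lemma norm_gsqr_ge:
  fixes a b :: "'k::real_normed_field"
  assumes m: "0 \<le> m" and ge: "\<And>u v. m \<le> norm ((a - of_real u)\<^sup>2 + (b - of_real v)\<^sup>2)"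
  shows "m ^ 2 ^ k \<le> norm ((fst (gsqr k (a, b)) - of_real u)\<^sup>2 + (snd (gsqr k (a, b)) - of_real v)\<^sup>2)"
proof (induction k arbitrary: u v)
  case 0 then show ?case using ge by simp
next
  case (Suc k)
  obtain a' b' where ab: "gsqr k (a, b) = (a', b')" by fastforce
  obtain s t where st: "s\<^sup>2 - t\<^sup>2 = u" "2 * s * t = v" by (rule real_gaussian_sqrt)
  have "(a'\<^sup>2 - b'\<^sup>2 - of_real u)\<^sup>2 + (2 * a' * b' - of_real v)\<^sup>2 =
      ((a' - of_real s)\<^sup>2 + (b' - of_real t)\<^sup>2) * ((a' - of_real (- s))\<^sup>2 + (b' - of_real (- t))\<^sup>2)"
    unfolding st[symmetric] by (simp add: power2_eq_square algebra_simps)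
  moreover have "m ^ 2 ^ k * m ^ 2 ^ k \<le> norm ((a' - of_real s)\<^sup>2 + (b' - of_real t)\<^sup>2) *
      norm ((a' - of_real (- s))\<^sup>2 + (b' - of_real (- t))\<^sup>2)"
    using Suc.IH[of s t] Suc.IH[of "- s" "- t"] m unfolding ab by (intro mult_mono) auto
  ultimately show ?case by (simp add: ab norm_mult power_double_exponent del: power_Suc)
qed

text \<open>A difference of squares again splits in two: the difference carries the induction, and
  the sum contributes \<open>m ^ 2 ^ k\<close> by \<open>norm_gsqr_ge\<close> at the negated real
  pair. The exponents \<open>1 + 2 + 4 + ...\<close> add up to \<open>2 ^ k - 1\<close>.\<close>

lemma norm_gsqr_diff_ge:
  fixes a b :: "'k::real_normed_field"
  assumes m: "0 \<le> m" and ge: "\<And>u v. m \<le> norm ((a - of_real u)\<^sup>2 + (b - of_real v)\<^sup>2)"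
  shows "norm ((a - of_real s)\<^sup>2 + (b - of_real t)\<^sup>2) * m ^ (2 ^ k - 1) \<le>
    norm ((fst (gsqr k (a, b)) - of_real (fst (gsqr k (s, t))))\<^sup>2 +
      (snd (gsqr k (a, b)) - of_real (snd (gsqr k (s, t))))\<^sup>2)"
proof (induction k)
  case (Suc k)
  obtain a' b' where ab: "gsqr k (a, b) = (a', b')" by fastforce
  obtain s' t' where st: "gsqr k (s, t) = (s', t')" by fastforce
  have "(a'\<^sup>2 - b'\<^sup>2 - of_real (s'\<^sup>2 - t'\<^sup>2))\<^sup>2 + (2 * a' * b' - of_real (2 * s' * t'))\<^sup>2 =
      ((a' - of_real s')\<^sup>2 + (b' - of_real t')\<^sup>2) * ((a' - of_real (- s'))\<^sup>2 + (b' - of_real (- t'))\<^sup>2)"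
    by (simp add: power2_eq_square algebra_simps)
  moreover have "(norm ((a - of_real s)\<^sup>2 + (b - of_real t)\<^sup>2) * m ^ (2 ^ k - 1)) * m ^ 2 ^ k \<le>
      norm ((a' - of_real s')\<^sup>2 + (b' - of_real t')\<^sup>2) *
      norm ((a' - of_real (- s'))\<^sup>2 + (b' - of_real (- t'))\<^sup>2)"
    using Suc.IH norm_gsqr_ge[OF assms, of k "- s'" "- t'"] m unfolding ab st
    by (intro mult_mono) auto
  moreover have "m ^ (2 ^ Suc k - 1) = m ^ (2 ^ k - 1) * m ^ 2 ^ k"
    by (simp add: mult_2 flip: power_add)
  ultimately show ?case by (simp add: ab st norm_mult mult.assoc del: power_Suc)
qed simp

lemma norm_gsqr_le:
  fixes a b :: "'k::real_normed_field"
  shows "norm (fst (gsqr k (a, b))) + norm (snd (gsqr k (a, b))) \<le> (norm a + norm b) ^ 2 ^ k"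
proof (induction k)
  case (Suc k)
  obtain a' b' where ab: "gsqr k (a, b) = (a', b')" by fastforce
  have "norm (a'\<^sup>2 - b'\<^sup>2) + norm (2 * a' * b') \<le> (norm a')\<^sup>2 + (norm b')\<^sup>2 + 2 * norm a' * norm b'"
    using norm_triangle_ineq4[of "a'\<^sup>2" "b'\<^sup>2"] by (simp add: norm_mult norm_power)
  also have "\<dots> = (norm a' + norm b')\<^sup>2" by (simp add: power2_eq_square algebra_simps)
  also have "\<dots> \<le> ((norm a + norm b) ^ 2 ^ k)\<^sup>2" using Suc.IH by (intro power_mono) (auto simp: ab)
  finally show ?case by (simp add: ab power_double_exponent power2_eq_square del: power_Suc)
qed simp

lemma norm_gsqr_form:
  fixes a b :: "'k::real_normed_field"
  shows "norm ((fst (gsqr k (a, b)))\<^sup>2 + (snd (gsqr k (a, b)))\<^sup>2) = norm (a\<^sup>2 + b\<^sup>2) ^ 2 ^ k"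
proof (induction k)
  case (Suc k)
  obtain a' b' where ab: "gsqr k (a, b) = (a', b')" by fastforce
  have "(a'\<^sup>2 - b'\<^sup>2)\<^sup>2 + (2 * a' * b')\<^sup>2 = (a'\<^sup>2 + b'\<^sup>2)\<^sup>2"
    by (simp add: power2_eq_square algebra_simps)
  then show ?case using Suc.IH
    by (simp add: ab norm_power power_double_exponent power2_eq_square[of "_ ^ _"] del: power_Suc)
qed simp

text \<open>
  With \<open>p = a + b \<i>\<close>, \<open>e = s + t \<i>\<close> and \<open>n = 2\<^sup>k\<close>, factor \<open>p\<^sup>n - e\<^sup>n\<close> into \<open>p - e\<close> and \<open>n - 1\<close> factors
  of form at least \<open>m\<close>, then let \<open>k\<close> tend to infinity.
\<close>

lemma minimum_stable:
  fixes a b :: "'k::real_normed_field"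
  assumes m: "0 < m" "norm (a\<^sup>2 + b\<^sup>2) = m"
    and ge: "\<And>u v. m \<le> norm ((a - of_real u)\<^sup>2 + (b - of_real v)\<^sup>2)"
    and small: "r * (norm a + norm b) < m" "r\<^sup>2 < m" "r = \<bar>s\<bar> + \<bar>t\<bar>"
  shows "norm ((a - of_real s)\<^sup>2 + (b - of_real t)\<^sup>2) = m"
proof (rule antisym[OF _ ge])
  define C where "C = norm a + norm b"
  define x where "x = norm ((a - of_real s)\<^sup>2 + (b - of_real t)\<^sup>2)"
  have C: "0 \<le> C" and r: "0 \<le> r" using small by (auto simp: C_def)
  \<comment> \<open>In the expanded form of the difference of \<open>n\<close>-th powers the main
    term has norm \<open>m ^ n\<close>, the mixed term at most four times
    \<open>C ^ n * r ^ n\<close>, and the last term at most two times the square of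
    \<open>r ^ n\<close>. Division by \<open>m ^ (n - 1)\<close> leaves powers of two ratios that
    are below 1 by \<open>small\<close>.\<close>
  have bound: "x \<le> m * (1 + 4 * (r * C / m) ^ 2 ^ k + 2 * (r\<^sup>2 / m) ^ 2 ^ k)" for k
  proof -
    define n :: nat where "n = 2 ^ k"
    obtain a' b' where ab: "gsqr k (a, b) = (a', b')" by fastforce
    obtain s' t' where st: "gsqr k (s, t) = (s', t')" by fastforce
    have a'b': "norm a' \<le> C ^ n" "norm b' \<le> C ^ n"
      using norm_gsqr_le[of k a b] norm_ge_zero[of a'] norm_ge_zero[of b']
      by (auto simp: ab C_def n_def simp del: norm_ge_zero)
    have s't': "\<bar>s'\<bar> \<le> r ^ n" "\<bar>t'\<bar> \<le> r ^ n"
      using norm_gsqr_le[of k s t] small(3) by (auto simp: st n_def)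
    have sq: "s'\<^sup>2 \<le> (r ^ n)\<^sup>2" "t'\<^sup>2 \<le> (r ^ n)\<^sup>2"
      using s't' r by (auto simp flip: abs_le_square_iff)
    have pr: "norm a' * \<bar>s'\<bar> \<le> C ^ n * r ^ n" "norm b' * \<bar>t'\<bar> \<le> C ^ n * r ^ n"
      using a'b' s't' C by (auto intro!: mult_mono)
    have "x * m ^ (n - 1) \<le> norm ((a' - of_real s')\<^sup>2 + (b' - of_real t')\<^sup>2)"
      using norm_gsqr_diff_ge[OF less_imp_le[OF m(1)] ge, of s t k] by (simp add: ab st x_def n_def)
    also have "(a' - of_real s')\<^sup>2 + (b' - of_real t')\<^sup>2 =
        (a'\<^sup>2 + b'\<^sup>2) - 2 * (a' * of_real s' + b' * of_real t') + of_real (s'\<^sup>2 + t'\<^sup>2)"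
      by (simp add: power2_eq_square algebra_simps)
    also have "norm \<dots> \<le> norm (a'\<^sup>2 + b'\<^sup>2) + 2 * (norm a' * \<bar>s'\<bar> + norm b' * \<bar>t'\<bar>) + (s'\<^sup>2 + t'\<^sup>2)"
    proof -
      have tri: "norm (A - 2 * z + w) \<le> norm A + 2 * p + q" if "norm z \<le> p" "norm w = q" for A z w :: 'k and p q
        using norm_triangle_ineq[of "A - 2 * z" w] norm_triangle_ineq4[of A "2 * z"] that
        by (simp add: norm_mult del: distrib_left_numeral)
      have "norm (a' * of_real s' + b' * of_real t') \<le> norm a' * \<bar>s'\<bar> + norm b' * \<bar>t'\<bar>"
        by (rule norm_triangle_le) (simp add: norm_mult)
      moreover have "norm (of_real (s'\<^sup>2 + t'\<^sup>2) :: 'k) = s'\<^sup>2 + t'\<^sup>2"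
        unfolding norm_of_real by simp
      ultimately show ?thesis by (rule tri)
    qed
    also have "\<dots> \<le> m ^ n + 4 * (C ^ n * r ^ n) + 2 * (r ^ n)\<^sup>2"
      using norm_gsqr_form[of k a b] pr sq by (simp add: ab m n_def)
    finally have "x * m ^ (n - 1) * m \<le> (m ^ n + 4 * (C ^ n * r ^ n) + 2 * (r ^ n)\<^sup>2) * m"
      using m by (intro mult_right_mono) auto
    moreover have "m ^ (n - 1) * m = m ^ n" by (intro power_minus_mult) (simp add: n_def)
    ultimately have "x * m ^ n \<le> (m ^ n + 4 * (C ^ n * r ^ n) + 2 * (r ^ n)\<^sup>2) * m"
      by (simp add: mult.assoc)
    then have "x \<le> (m ^ n + 4 * (C ^ n * r ^ n) + 2 * (r ^ n)\<^sup>2) * m / m ^ n"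
      using m by (simp add: pos_le_divide_eq)
    also have "\<dots> = m * (1 + 4 * (r * C / m) ^ n + 2 * (r\<^sup>2 / m) ^ n)"
    proof -
      have "(r * C / m) ^ n = C ^ n * r ^ n / m ^ n" "(r\<^sup>2 / m) ^ n = (r ^ n)\<^sup>2 / m ^ n"
        by (simp_all add: power_divide power_mult_distrib mult.commute power_even_eq[symmetric] power_mult[symmetric])
      then show ?thesis using m by (simp add: field_simps)
    qed
    finally show ?thesis by (simp add: n_def)
  qed
  have two: "filterlim (\<lambda>k. 2 ^ k :: nat) sequentially sequentially"
    by (intro filterlim_subseq) (simp add: strict_mono_def)
  have "(\<lambda>n. q ^ n) \<longlonglongrightarrow> 0" if "0 \<le> q" "q < 1" for q :: real
    using that by (intro LIMSEQ_power_zero) auto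
  then have lim: "(\<lambda>k. q ^ 2 ^ k) \<longlonglongrightarrow> 0" if "0 \<le> q" "q < 1" for q :: real
    using that by (intro filterlim_compose[OF _ two]) auto
  have "(\<lambda>k. m * (1 + 4 * (r * C / m) ^ 2 ^ k + 2 * (r\<^sup>2 / m) ^ 2 ^ k)) \<longlonglongrightarrow> m * (1 + 4 * 0 + 2 * 0)"
    using m C r small by (intro tendsto_intros lim) (auto simp: C_def)
  then have "x \<le> m * (1 + 4 * 0 + 2 * 0)"
    using bound by (intro LIMSEQ_le_const) auto
  then show "norm ((a - of_real s)\<^sup>2 + (b - of_real t)\<^sup>2) \<le> m" by (simp add: x_def)
qed

text \<open>
  By \<open>minimum_stable\<close>, a nonzero minimum of the coercive function
  \<open>(x, y) \<mapsto> \<parallel>(\<xi> - x)\<^sup>2 + y\<^sup>2\<parallel>\<close> could not be attained at a point with maximal \<open>x\<close>.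
\<close>

lemma real_quadratic_root:
  fixes \<xi> :: "'k::real_normed_field"
  obtains x y :: real where "(\<xi> - of_real x)\<^sup>2 + (of_real y)\<^sup>2 = 0"
proof -
  define f where "f = (\<lambda>w :: real \<times> real. norm ((\<xi> - of_real (fst w))\<^sup>2 + (of_real (snd w))\<^sup>2))"
  have cont: "continuous_on A f" for A unfolding f_def by (intro continuous_intros)
  have coercive: "(norm w)\<^sup>2 \<le> f w + 2 * norm w * norm \<xi> + (norm \<xi>)\<^sup>2" for w
  proof -
    obtain x y where w: "w = (x, y)" by fastforce
    have n: "(norm w)\<^sup>2 = x\<^sup>2 + y\<^sup>2" by (simp add: w norm_prod_def)
    have "\<bar>x\<bar> \<le> norm w" using norm_fst_le[of x y] by (simp add: w)
    then have x: "2 * \<bar>x\<bar> * norm \<xi> \<le> 2 * norm w * norm \<xi>" by (simp add: mult_right_mono)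
    have "of_real (x\<^sup>2 + y\<^sup>2) = ((\<xi> - of_real x)\<^sup>2 + (of_real y)\<^sup>2) + (2 * of_real x * \<xi> - \<xi>\<^sup>2)"
      by (simp add: power2_eq_square algebra_simps)
    then have "norm (of_real (x\<^sup>2 + y\<^sup>2) :: 'k) \<le> f w + norm (2 * of_real x * \<xi> - \<xi>\<^sup>2)"
      using norm_triangle_ineq by (simp add: f_def w del: of_real_add)
    also have "norm (2 * of_real x * \<xi> - \<xi>\<^sup>2) \<le> 2 * \<bar>x\<bar> * norm \<xi> + (norm \<xi>)\<^sup>2"
      using norm_triangle_ineq4[of "2 * of_real x * \<xi>" "\<xi>\<^sup>2"] by (simp add: norm_mult norm_power)
    finally show ?thesis using x unfolding n norm_of_real by simp
  qed
  \<comment> \<open>Beyond this radius the quadratic growth in \<open>coercive\<close> pushes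
    \<open>f\<close> above \<open>f 0\<close>, so a minimum over the ball is a global one.\<close>
  have bounded: "norm w \<le> f 0 + 2 * norm \<xi> + (norm \<xi>)\<^sup>2 + 1" if "f w \<le> f 0" for w
  proof (rule ccontr)
    assume *: "\<not> ?thesis"
    have f0: "0 \<le> f 0" by (simp add: f_def)
    define N where "N = norm w"
    have N: "1 \<le> N" "f 0 + 2 * norm \<xi> + (norm \<xi>)\<^sup>2 + 1 < N" using * f0
      by (auto simp: N_def) (smt (verit) norm_ge_zero zero_le_power2)
    have "N * (f 0 + 2 * norm \<xi> + (norm \<xi>)\<^sup>2 + 1) < N * N" using N by simp
    moreover have "f 0 \<le> N * f 0" "(norm \<xi>)\<^sup>2 \<le> N * (norm \<xi>)\<^sup>2"
      using N f0 by (auto simp: mult_le_cancel_right1)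
    ultimately show False
      using coercive[of w] that N by (simp add: N_def power2_eq_square algebra_simps)
  qed
  define B where "B = f 0 + 2 * norm \<xi> + (norm \<xi>)\<^sup>2 + 1"
  have "0 \<le> B" by (simp add: B_def f_def)
  obtain w0 where w0: "w0 \<in> cball 0 B" "\<And>w. w \<in> cball 0 B \<Longrightarrow> f w0 \<le> f w"
    using continuous_attains_inf[of "cball 0 B" f] cont \<open>0 \<le> B\<close> by auto
  define m where "m = f w0"
  have min: "m \<le> f w" for w
    using w0(2)[of w] w0(2)[of 0] \<open>0 \<le> B\<close> bounded[of w] by (fastforce simp: m_def B_def)
  have small: "norm w \<le> B" if "f w = m" for w
    using bounded[of w] min[of 0] that by (simp add: B_def)
  define S where "S = cball 0 B \<inter> f -` {m}"
  have "compact S" unfolding S_def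
    by (intro compact_Int_closed compact_cball continuous_closed_vimage)
      (auto simp: cont continuous_at_imp_continuous_on intro!: cont[of UNIV, unfolded continuous_on_eq_continuous_at[OF open_UNIV], rule_format])
  moreover have "w0 \<in> S" using w0 by (simp add: S_def m_def)
  ultimately obtain w1 where w1: "w1 \<in> S" "\<And>w. w \<in> S \<Longrightarrow> fst w \<le> fst w1"
    using continuous_attains_sup[of S fst] continuous_on_fst[OF continuous_on_id] by blast
  have "m = 0"
  proof (rule ccontr)
    assume "m \<noteq> 0"
    moreover have "0 \<le> m" by (simp add: m_def f_def)
    ultimately have m: "0 < m" by simp
    define a b where "a = \<xi> - of_real (fst w1)" and "b = (of_real (snd w1) :: 'k)"
    define C where "C = norm a + norm b + 1"
    have C: "1 \<le> C" by (simp add: C_def)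
    \<comment> \<open>The step size keeps both \<open>s * C\<close> and the square of
      \<open>s\<close> at most \<open>m / 2\<close>, which supplies the smallness hypotheses of
      \<open>minimum_stable\<close>.\<close>
    define s where "s = min (m / (2 * C)) (min 1 (m / 2))"
    have s: "0 < s" "s \<le> m / (2 * C)" "s \<le> 1" "s \<le> m / 2" using m C by (auto simp: s_def)
    have "s * (norm a + norm b) \<le> s * C" using s by (intro mult_left_mono) (auto simp: C_def)
    also have "\<dots> \<le> m / (2 * C) * C" using s C by (intro mult_right_mono) auto
    also have "\<dots> < m" using m C by simp
    finally have 1: "s * (norm a + norm b) < m" .
    have "s * s \<le> 1 * (m / 2)" using s by (intro mult_mono) auto
    then have 2: "s\<^sup>2 < m" using m by (simp add: power2_eq_square)
    have "norm ((a - of_real s)\<^sup>2 + (b - of_real 0)\<^sup>2) = m"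
    proof (rule minimum_stable[OF m _ _ 1 2])
      show "norm (a\<^sup>2 + b\<^sup>2) = m" using w1(1) by (simp add: S_def f_def a_def b_def)
      show "m \<le> norm ((a - of_real u)\<^sup>2 + (b - of_real v)\<^sup>2)" for u v
        \<comment> \<open>The first coordinate enters \<open>a\<close> with a minus sign and the
          second enters \<open>b\<close> with a plus sign, hence the opposite shifts.\<close>
        using min[of "(fst w1 + u, snd w1 - v)"] by (simp add: f_def a_def b_def diff_diff_eq)
    qed (use s in auto)
    then have "f (fst w1 + s, snd w1) = m" by (simp add: f_def a_def b_def diff_diff_eq)
    then have "(fst w1 + s, snd w1) \<in> S" using small by (simp add: S_def)
    then show False using w1(2) s(1) by fastforce
  qed
  then have "(\<xi> - of_real (fst w0))\<^sup>2 + (of_real (snd w0))\<^sup>2 = 0" by (simp add: m_def f_def)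
  then show ?thesis by (rule that)
qed

text \<open>An imaginary unit factors the sum of squares from \<open>real_quadratic_root\<close>
  into linear terms. Without one, \<open>y\<close> must vanish, as
  \<open>(c - of_real x) / of_real y\<close> would be an imaginary unit. The value
  \<open>j = 0\<close> encodes the real case, so that both cases share one formula.\<close>

lemma real_normed_field_real_or_complex:
  obtains j :: "'k::real_normed_field" where "j = 0 \<or> j\<^sup>2 = -1"
    and "\<And>c. \<exists>p q. c = of_real p + of_real q * j"
proof (cases "\<exists>j :: 'k. j\<^sup>2 = -1")
  case True
  then obtain j :: 'k where j: "j\<^sup>2 = -1" by blast
  have "\<exists>p q. c = of_real p + of_real q * j" for c
  proof -
    obtain x y where "(c - of_real x)\<^sup>2 + (of_real y)\<^sup>2 = 0" by (rule real_quadratic_root)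
    moreover have "(c - of_real x)\<^sup>2 + (of_real y)\<^sup>2 =
        (c - of_real x - of_real y * j) * (c - of_real x + of_real y * j)"
      using j by (simp add: algebra_simps power2_eq_square) (simp flip: mult.assoc)
    ultimately have "c - of_real x - of_real y * j = 0 \<or> c - of_real x + of_real y * j = 0" by simp
    then consider "c = of_real x + of_real y * j" | "c = of_real x + of_real (- y) * j"
      by (auto simp: algebra_simps)
    then show ?thesis by cases blast+
  qed
  then show ?thesis using that j by blast
next
  case False
  have "\<exists>p q. c = of_real p + of_real q * 0" for c :: 'k
  proof -
    obtain x y where xy: "(c - of_real x)\<^sup>2 + (of_real y)\<^sup>2 = 0" by (rule real_quadratic_root)
    have "y = 0"
    proof (rule ccontr)
      assume "y \<noteq> 0"
      then have "((c - of_real x) / of_real y)\<^sup>2 = -1"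
        using xy by (simp add: power_divide divide_eq_eq flip: eq_neg_iff_add_eq_0)
      then show False using False by blast
    qed
    then show ?thesis using xy by (auto simp: algebra_simps)
  qed
  then show ?thesis using that[of 0] by blast
qed

section \<open>An injective tensor square of the algebra, with actions on either factor\<close>

section \<open>Tensors as operators on the dual space\<close>

text \<open>The case \<open>j = 0\<close> is that of real scalars; otherwise \<open>j\<close> is an imaginary unit.\<close>

locale banach_algebra_imaginary = banach_algebra scl
  for scl :: "'k::{real_normed_field,banach} \<Rightarrow> 'a::{real_normed_algebra,banach} \<Rightarrow> 'a" +
  fixes j :: 'k
  assumes j_cases: "j = 0 \<or> j\<^sup>2 = -1"
    and decomp: "\<exists>p q. c = of_real p + of_real q * j"
begin

lemma bounded_linear_scl: "bounded_linear (scl c)"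
proof (rule bounded_linear_intro[where K = "norm c"])
  show "scl c (r *\<^sub>R x) = r *\<^sub>R scl c x" for r x
    by (metis scale_left_commute scale_of_real)
qed (simp_all add: scale_right_distrib norm_scale mult.commute)

definition scl_op :: "'k \<Rightarrow> 'a \<Rightarrow>\<^sub>L 'a" where "scl_op c = Blinfun (scl c)"

lemma scl_op_apply [simp]: "blinfun_apply (scl_op c) = scl c"
  unfolding scl_op_def by (rule bounded_linear_Blinfun_apply[OF bounded_linear_scl])

lemma norm_j_le: "norm j \<le> 1"
proof -
  have "(norm j)\<^sup>2 \<le> 1\<^sup>2" using j_cases by (auto simp flip: norm_power)
  then show ?thesis using abs_le_square_iff[of "norm j" 1] by simp
qed

text \<open>The \<open>'k\<close>-linear functional whose real part is \<open>\<phi>\<close>.\<close>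

definition coeff :: "('a \<Rightarrow>\<^sub>L real) \<Rightarrow> 'a \<Rightarrow> 'k"
  where "coeff \<phi> y = of_real (\<phi> y) - j * of_real (\<phi> (scl j y))"

lemma coeff_add: "coeff \<phi> (x + y) = coeff \<phi> x + coeff \<phi> y"
  by (simp add: coeff_def scale_right_distrib blinfun.add_right algebra_simps)

lemma coeff_scaleR: "coeff \<phi> (r *\<^sub>R y) = of_real r * coeff \<phi> y"
proof -
  have "scl j (r *\<^sub>R y) = r *\<^sub>R scl j y" by (rule linear_cmul[OF bounded_linear.linear[OF bounded_linear_scl]])
  then show ?thesis by (simp add: coeff_def blinfun.scaleR_right algebra_simps)
qed

lemma coeff_j: "coeff \<phi> (scl j y) = j * coeff \<phi> y"
proof (cases "j = 0")
  case True
  then show ?thesis unfolding coeff_def by (simp add: blinfun.zero_right)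
next
  case False
  then have j: "j\<^sup>2 = -1" using j_cases by simp
  have "scl j (scl j y) = - y" using j by (simp add: power2_eq_square)
  then have "coeff \<phi> (scl j y) = of_real (\<phi> (scl j y)) + j * of_real (\<phi> y)"
    by (simp add: coeff_def blinfun.minus_right)
  also have "\<dots> = j * of_real (\<phi> y) - j\<^sup>2 * of_real (\<phi> (scl j y))" by (simp add: j)
  finally show ?thesis by (simp add: coeff_def algebra_simps power2_eq_square)
qed

lemma coeff_scl: "coeff \<phi> (scl c y) = c * coeff \<phi> y"
proof -
  obtain p q where c: "c = of_real p + of_real q * j" using decomp by blast
  have "scl c y = p *\<^sub>R y + q *\<^sub>R scl j y"
    by (simp add: c scale_left_distrib scale_of_real flip: scale_scale)
  then show ?thesis by (simp add: coeff_add coeff_scaleR coeff_j) (simp add: c algebra_simps)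
qed

lemma norm_coeff_le: "norm (coeff \<phi> y) \<le> 2 * norm \<phi> * norm y"
proof -
  have "norm (scl j y) \<le> norm y" using norm_j_le by (simp add: norm_scale mult_left_le_one_le)
  then have "\<bar>\<phi> (scl j y)\<bar> \<le> norm \<phi> * norm y"
    using norm_blinfun[of \<phi> "scl j y"] by simp (meson mult_left_mono norm_ge_zero order_trans)
  then have "norm j * \<bar>\<phi> (scl j y)\<bar> \<le> norm \<phi> * norm y"
    using norm_j_le mult_left_le_one_le[of "\<bar>\<phi> (scl j y)\<bar>" "norm j"] by simp
  then show ?thesis
    using norm_triangle_ineq4[of "of_real (\<phi> y) :: 'k" "j * of_real (\<phi> (scl j y))"]
      norm_blinfun[of \<phi> y] by (simp add: coeff_def norm_mult)
qed

text \<open>The product of \<open>p - j * q\<close> with its conjugate \<open>p + j * q\<close> has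
  norm equal to the sum of the squares of \<open>p\<close> and \<open>q\<close>, while the conjugate
  has norm at most \<open>\<bar>p\<bar> + \<bar>q\<bar>\<close>. If the claim failed, these two
  facts and the inequality between the means would give \<open>p = 0\<close>.\<close>

lemma norm_coeff_ge:
  fixes \<phi> :: "'a \<Rightarrow>\<^sub>L real"
  shows "\<bar>\<phi> y\<bar> \<le> 2 * norm (coeff \<phi> y)"
proof (cases "j = 0")
  case False
  then have j: "j\<^sup>2 = -1" using j_cases by simp
  define p q where "p = \<phi> y" and "q = \<phi> (scl j y)"
  have "(of_real p - j * of_real q) * (of_real p + j * of_real q) = (of_real p)\<^sup>2 - j\<^sup>2 * (of_real q)\<^sup>2"
    by (simp add: power2_eq_square algebra_simps)
  also have "\<dots> = of_real (p\<^sup>2 + q\<^sup>2)" by (simp add: j)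
  finally have "norm (of_real p - j * of_real q) * norm (of_real p + j * of_real q) = norm (of_real (p\<^sup>2 + q\<^sup>2) :: 'k)"
    by (metis norm_mult)
  then have prod: "norm (coeff \<phi> y) * norm (of_real p + j * of_real q) = p\<^sup>2 + q\<^sup>2"
    unfolding norm_of_real by (simp add: coeff_def p_def q_def)
  have "norm (j * of_real q) \<le> \<bar>q\<bar>" using norm_j_le by (simp add: norm_mult mult_left_le_one_le)
  then have le: "norm (of_real p + j * of_real q) \<le> \<bar>p\<bar> + \<bar>q\<bar>"
    using norm_triangle_ineq[of "of_real p :: 'k" "j * of_real q"] by simp
  show ?thesis
  proof (rule ccontr)
    assume "\<not> ?thesis"
    then have less: "2 * norm (coeff \<phi> y) < \<bar>p\<bar>" by (simp add: p_def)
    have "2 * (p\<^sup>2 + q\<^sup>2) \<le> 2 * norm (coeff \<phi> y) * (\<bar>p\<bar> + \<bar>q\<bar>)"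
      using mult_left_mono[OF le, of "2 * norm (coeff \<phi> y)"] prod by simp
    also have "\<dots> \<le> \<bar>p\<bar> * (\<bar>p\<bar> + \<bar>q\<bar>)" using less by (intro mult_right_mono) auto
    also have "\<dots> = p\<^sup>2 + \<bar>p\<bar> * \<bar>q\<bar>" by (simp add: algebra_simps power2_eq_square abs_mult_self_eq)
    finally have "p\<^sup>2 + 2 * q\<^sup>2 \<le> \<bar>p\<bar> * \<bar>q\<bar>" by simp
    moreover have "2 * (\<bar>p\<bar> * \<bar>q\<bar>) \<le> p\<^sup>2 + q\<^sup>2"
      using sum_squares_bound[of "\<bar>p\<bar>" "\<bar>q\<bar>"] by simp
    ultimately have "p\<^sup>2 \<le> 0" by (smt (verit) zero_le_power2)
    then show False using less by simp
  qed
next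
  case True
  then show ?thesis unfolding coeff_def by simp
qed

text \<open>The tensor x \<otimes> y as a rank-one operator on the real dual; \<open>coeff\<close>
  makes it balanced over \<open>'k\<close>. The operator norm plays the part of the injective tensor
  norm.\<close>

definition tens :: "'a \<Rightarrow> 'a \<Rightarrow> ('a \<Rightarrow>\<^sub>L real) \<Rightarrow>\<^sub>L 'a"
  where "tens x y = Blinfun (\<lambda>\<phi>. scl (coeff \<phi> y) x)"

lemma tens_apply [simp]: "tens x y \<phi> = scl (coeff \<phi> y) x"
proof -
  have "bounded_linear (\<lambda>\<phi>. scl (coeff \<phi> y) x)"
  proof (rule bounded_linear_intro[where K = "2 * norm x * norm y"])
    show "scl (coeff (\<phi> + \<psi>) y) x = scl (coeff \<phi> y) x + scl (coeff \<psi> y) x" for \<phi> \<psi>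
      by (simp add: coeff_def plus_blinfun.rep_eq algebra_simps flip: scale_left_distrib)
    show "scl (coeff (r *\<^sub>R \<phi>) y) x = r *\<^sub>R scl (coeff \<phi> y) x" for r \<phi>
    proof -
      have "coeff (r *\<^sub>R \<phi>) y = of_real r * coeff \<phi> y"
        by (simp add: coeff_def scaleR_blinfun.rep_eq algebra_simps)
      then show ?thesis by (simp add: scale_of_real flip: scale_scale)
    qed
    show "norm (scl (coeff \<phi> y) x) \<le> norm \<phi> * (2 * norm x * norm y)" for \<phi>
      using mult_right_mono[OF norm_coeff_le[of \<phi> y], of "norm x"] by (simp add: norm_scale algebra_simps)
  qed
  then show ?thesis by (simp add: tens_def bounded_linear_Blinfun_apply)
qed

lemma norm_tens_le: "norm (tens x y) \<le> 2 * norm x * norm y"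
proof (rule norm_blinfun_bound)
  show "norm (tens x y \<phi>) \<le> 2 * norm x * norm y * norm \<phi>" for \<phi>
    using mult_right_mono[OF norm_coeff_le[of \<phi> y], of "norm x"] by (simp add: norm_scale algebra_simps)
qed simp

text \<open>The operator is tested on a functional norming \<open>y\<close>; the factor 2 is the
  loss in \<open>norm_coeff_ge\<close>.\<close>

lemma norm_tens_ge: "norm x * norm y \<le> 2 * norm (tens x y)"
proof -
  obtain \<phi> :: "'a \<Rightarrow>\<^sub>L real" where \<phi>: "norm \<phi> \<le> 1" "\<phi> y = norm y" by (rule norming_functional)
  have "norm y * norm x \<le> 2 * norm (coeff \<phi> y) * norm x"
    using norm_coeff_ge[of \<phi> y] \<phi>(2) by (intro mult_right_mono) auto
  also have "\<dots> = 2 * norm (tens x y \<phi>)" by (simp add: norm_scale)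
  also have "\<dots> \<le> 2 * (norm (tens x y) * norm \<phi>)" using norm_blinfun[of "tens x y" \<phi>] by simp
  also have "\<dots> \<le> 2 * (norm (tens x y) * 1)" using \<phi>(1) by (intro mult_left_mono) auto
  finally show ?thesis by (simp add: mult.commute)
qed

lemma tens_add_left: "tens (x + x') y = tens x y + tens x' y"
  by (rule blinfun_eqI) (simp add: plus_blinfun.rep_eq scale_right_distrib)

lemma tens_add_right: "tens x (y + y') = tens x y + tens x y'"
  by (rule blinfun_eqI) (simp add: plus_blinfun.rep_eq coeff_add scale_left_distrib)

lemma tens_scl_left: "tens (scl c x) y = scl_op c o\<^sub>L tens x y"
  by (rule blinfun_eqI) (simp add: mult.commute)

lemma tens_scl_right: "tens x (scl c y) = scl_op c o\<^sub>L tens x y"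
  by (rule blinfun_eqI) (simp add: coeff_scl)

text \<open>The transpose of \<open>Q\<close>. Composing with it on the right acts on the second
  tensor factor, just as composing on the left acts on the first.\<close>

definition precomp :: "('a \<Rightarrow>\<^sub>L 'a) \<Rightarrow> ('a \<Rightarrow>\<^sub>L real) \<Rightarrow>\<^sub>L ('a \<Rightarrow>\<^sub>L real)"
  where "precomp Q = Blinfun (\<lambda>\<phi>. \<phi> o\<^sub>L Q)"

lemma precomp_apply [simp]: "precomp Q \<phi> = \<phi> o\<^sub>L Q"
  by (simp add: precomp_def bounded_linear_Blinfun_apply
      bounded_bilinear.bounded_linear_left[OF bounded_bilinear_blinfun_compose])

lemma norm_precomp: "norm (precomp Q) \<le> norm Q"
  by (rule norm_blinfun_bound) (simp_all add: norm_blinfun_compose mult.commute[of "norm Q"])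

lemma compose_tens:
  fixes P :: "'a \<Rightarrow>\<^sub>L 'a"
  assumes "\<And>c x. P (scl c x) = scl c (P x)"
  shows "P o\<^sub>L tens x y = tens (P x) y"
  by (rule blinfun_eqI) (simp add: assms)

lemma tens_precomp:
  fixes Q :: "'a \<Rightarrow>\<^sub>L 'a"
  assumes "\<And>c x. Q (scl c x) = scl c (Q x)"
  shows "tens x y o\<^sub>L precomp Q = tens x (Q y)"
  by (rule blinfun_eqI) (simp add: coeff_def assms)

text \<open>The real span is stable under \<open>'k\<close> because a scalar can be absorbed into a
  factor. The closure makes the bimodule below complete.\<close>

definition tensors :: "(('a \<Rightarrow>\<^sub>L real) \<Rightarrow>\<^sub>L 'a) set"
  where "tensors = closure (Real_Vector_Spaces.span (range (case_prod tens)))"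

lemma tens_in: "tens x y \<in> tensors"
  unfolding tensors_def using closure_subset real_vector.span_base[of "tens x y" "range (case_prod tens)"]
  by (metis rangeI case_prod_conv subsetD)

lemma subspace_tensors: "Real_Vector_Spaces.subspace tensors"
proof (rule real_vector.subspaceI)
  show "0 \<in> tensors" using closure_subset real_vector.span_zero unfolding tensors_def by blast
next
  fix s t assume "s \<in> tensors" "t \<in> tensors"
  then obtain f g where "\<And>n. f n \<in> Real_Vector_Spaces.span (range (case_prod tens))" "f \<longlonglongrightarrow> s"
    "\<And>n. g n \<in> Real_Vector_Spaces.span (range (case_prod tens))" "g \<longlonglongrightarrow> t"
    unfolding tensors_def closure_sequential by blast
  then show "s + t \<in> tensors" unfolding tensors_def closure_sequential
    by (intro exI[of _ "\<lambda>n. f n + g n"]) (auto intro: real_vector.span_add tendsto_add)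
next
  fix r t assume "t \<in> tensors"
  then obtain f where "\<And>n. f n \<in> Real_Vector_Spaces.span (range (case_prod tens))" "f \<longlonglongrightarrow> t"
    unfolding tensors_def closure_sequential by blast
  then show "r *\<^sub>R t \<in> tensors" unfolding tensors_def closure_sequential
    by (intro exI[of _ "\<lambda>n. r *\<^sub>R f n"]) (auto intro: real_vector.span_scale tendsto_scaleR)
qed

lemma closed_tensors: "closed tensors" by (simp add: tensors_def)

text \<open>The density principle through which invariance, identities and limits are checked on
  elementary tensors only.\<close>

lemma tensors_subset:
  assumes "closed S" "Real_Vector_Spaces.subspace S" "\<And>x y. tens x y \<in> S"
  shows "tensors \<subseteq> S"
  unfolding tensors_def using assms by (intro closure_minimal real_vector.span_minimal) auto

lemma tensors_image:
  assumes h: "bounded_linear h" and tens: "\<And>x y. h (tens x y) \<in> tensors" and "t \<in> tensors"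
  shows "h t \<in> tensors"
proof -
  have "tensors \<subseteq> h -` tensors"
  proof (rule tensors_subset)
    show "closed (h -` tensors)"
      using h closed_tensors by (intro continuous_closed_vimage linear_continuous_at)
    show "Real_Vector_Spaces.subspace (h -` tensors)"
      using bounded_linear.linear[OF h] subspace_tensors by (rule linear_subspace_vimage)
  qed (simp add: tens)
  then show ?thesis using \<open>t \<in> tensors\<close> by blast
qed

lemma tensors_eq:
  assumes f: "bounded_linear f" and g: "bounded_linear g"
    and tens: "\<And>x y. f (tens x y) = g (tens x y)" and "t \<in> tensors"
  shows "f t = g t"
proof -
  have "tensors \<subseteq> {t. f t = g t}"
  proof (rule tensors_subset)
    show "closed {t. f t = g t}"
      using f g by (intro closed_Collect_eq linear_continuous_on)
    show "Real_Vector_Spaces.subspace {t. f t = g t}"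
      using f g by (auto intro!: real_vector.subspaceI simp: linear_simps bounded_linear.linear linear_0)
  qed (simp add: tens)
  then show ?thesis using \<open>t \<in> tensors\<close> by blast
qed

text \<open>Uniformly bounded operators that tend to zero on elementary tensors do so on their
  closed span: approximate \<open>t\<close> within a multiple of \<open>e\<close> and split the
  error. This is how limits of multipliers reach the components \<open>M\<close>.\<close>

lemma tensors_tendsto_zero:
  fixes h :: "'i \<Rightarrow> (('a \<Rightarrow>\<^sub>L real) \<Rightarrow>\<^sub>L 'a) \<Rightarrow> 'b::real_normed_vector"
  assumes lin: "\<And>i. linear (h i)" and bound: "\<forall>\<^sub>F i in F. \<forall>t. norm (h i t) \<le> B * norm t"
    and tens: "\<And>x y. ((\<lambda>i. h i (tens x y)) \<longlongrightarrow> 0) F" and t: "t \<in> tensors"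
  shows "((\<lambda>i. h i t) \<longlongrightarrow> 0) F"
proof (cases "F = bot")
  case False
  \<comment> \<open>The constant is made positive so that it can be divided by.\<close>
  have bound': "\<forall>\<^sub>F i in F. \<forall>t. norm (h i t) \<le> (\<bar>B\<bar> + 1) * norm t"
    using bound by eventually_elim (meson abs_ge_self add_increasing2 mult_right_mono norm_ge_zero order_trans zero_le_one)
  define S where "S = {t. ((\<lambda>i. h i t) \<longlongrightarrow> 0) F}"
  have "tensors \<subseteq> S"
  proof (rule tensors_subset)
    show "Real_Vector_Spaces.subspace S"
      unfolding S_def using lin
      by (auto intro!: real_vector.subspaceI tendsto_eq_intros simp: linear_0 linear_add linear_cmul)
    show "closed S"
    proof (unfold closed_sequential_limits, intro allI impI)
      fix s t assume st: "(\<forall>n. s n \<in> S) \<and> s \<longlonglongrightarrow> t"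
      have "\<forall>\<^sub>F i in F. norm (h i t) < e" if e: "0 < e" for e
      proof -
        have "0 < e / (2 * (\<bar>B\<bar> + 1))" using e by simp
        then obtain n where n: "norm (s n - t) < e / (2 * (\<bar>B\<bar> + 1))"
          using st LIMSEQ_D by blast
        have "((\<lambda>i. h i (s n)) \<longlongrightarrow> 0) F" using st by (simp add: S_def)
        then have "\<forall>\<^sub>F i in F. norm (h i (s n)) < e / 2"
          using e tendstoD[of "\<lambda>i. h i (s n)" 0 F "e / 2"] by simp
        with bound' show ?thesis
        proof eventually_elim
          case (elim i)
          have "h i t = h i (s n) - h i (s n - t)" using lin by (simp add: linear_diff)
          then have "norm (h i t) \<le> norm (h i (s n)) + norm (h i (s n - t))"
            by (metis norm_triangle_ineq4)
          also have "norm (h i (s n - t)) \<le> (\<bar>B\<bar> + 1) * norm (s n - t)" using elim by blast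
          also have "\<dots> \<le> (\<bar>B\<bar> + 1) * (e / (2 * (\<bar>B\<bar> + 1)))" using n by (intro mult_left_mono) auto
          also have "\<dots> = e / 2" by (simp add: field_simps)
          finally show ?case using elim by simp
        qed
      qed
      then show "t \<in> S" by (auto simp: S_def tendsto_iff)
    qed
  qed (simp add: S_def tens)
  then show ?thesis using t by (auto simp: S_def)
qed simp

end

section \<open>Bounds along a subnet: the abstract argument and its two mirror images\<close>

section \<open>Boundedness of one-sided approximate identities\<close>

text \<open>
  Multiplication, tensors and operations are kept abstract so that the statement applies to \<open>F\<close> and,
  with both multiplication and tensor factors reversed, to \<open>G\<close>. The operation \<open>q z\<close> acts as
  \<open>y \<mapsto> y - z y\<close> on the second tensor factor.
\<close>

lemma frequently_bounded_net:
  fixes F G :: "'i \<Rightarrow> 'a::real_normed_vector" and M :: "'i \<Rightarrow> 'e::real_normed_vector"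
    and tens :: "'a \<Rightarrow> 'a \<Rightarrow> 'e" and lm rm q :: "'a \<Rightarrow> 'e \<Rightarrow> 'e"
  assumes U: "U \<noteq> bot" and mul: "bounded_bilinear mul" and K: "0 \<le> K"
    and tens_le: "\<And>x y. norm (tens x y) \<le> 2 * norm x * norm y"
    and tens_ge: "\<And>x y. norm x * norm y \<le> 2 * norm (tens x y)"
    and lm_le: "\<And>a t. norm (lm a t) \<le> norm a * norm t"
    and q_linear: "\<And>z. linear (q z)"
    and q_tens: "\<And>z x y. q z (tens x y) = tens x (y - mul z y)"
    and q_lm: "\<And>z a t. q z (lm a t) = lm a (q z t)"
    and q_le: "\<And>z t. (\<And>y. norm (mul z y) \<le> K * norm y) \<Longrightarrow> norm (q z t) \<le> (1 + K) * norm t"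
    and right: "\<And>a. ((\<lambda>i. mul a (F i)) \<longlongrightarrow> a) U"
    and left: "\<And>a. ((\<lambda>i. mul (G i) a) \<longlongrightarrow> a) U"
    and left_le: "\<forall>\<^sub>F i in U. \<forall>a. norm (mul (G i) a) \<le> K * norm a"
    and comm_le: "\<forall>\<^sub>F i in U. \<forall>a.
      norm (tens a (G i) + lm a (M i) - rm a (M i) - tens (F i) a) \<le> K * norm a"
    and q_lim: "\<forall>\<^sub>F i in U. ((\<lambda>l. q (G l) (M i)) \<longlongrightarrow> 0) U"
    and rm_lim: "\<forall>\<^sub>F i in U. \<forall>f. (\<forall>l. norm (f l) \<le> 1) \<longrightarrow>
      (\<forall>b. ((\<lambda>l. mul b (f l)) \<longlongrightarrow> 0) U) \<longrightarrow> ((\<lambda>l. rm (f l) (M i)) \<longlongrightarrow> 0) U"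
  shows "\<exists>B. \<exists>\<^sub>F i in U. norm (F i) \<le> B"
proof (rule ccontr)
  interpret mul: bounded_bilinear mul by (rule mul)
  assume "\<not> ?thesis"
  then have large: "\<forall>\<^sub>F i in U. B < norm (F i)" for B
    by (auto simp: not_frequently not_le)
  then have at_top: "filterlim (\<lambda>i. norm (F i)) at_top U"
    by (simp add: filterlim_at_top_dense)
  define f where "f i = F i /\<^sub>R norm (F i)" for i
  have f_le: "norm (f i) \<le> 1" for i by (cases "F i = 0") (simp_all add: f_def)
  have f_lim: "((\<lambda>i. mul b (f i)) \<longlongrightarrow> 0) U" for b
  proof -
    have "((\<lambda>i. inverse (norm (F i)) *\<^sub>R mul b (F i)) \<longlongrightarrow> 0 *\<^sub>R b) U"
      by (intro tendsto_scaleR tendsto_inverse_0_at_top at_top right)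
    then show ?thesis by (simp add: f_def mul.scaleR_right)
  qed
  \<comment> \<open>\<open>B / 4\<close> is the sum of the bounds \<open>2\<close>,
    \<open>1\<close>, \<open>1 + K\<close> and \<open>(1 + K) * K\<close> on the four terms below.
    The factor 4 pays for the 2 in \<open>tens_ge\<close> and for the lower bound 1/2 on
    \<open>norm (a - mul (G l) a)\<close>.\<close>
  define B where "B = 4 * (K * (1 + K) + 3 + (1 + K))"
  have "\<forall>\<^sub>F i in U. B < norm (F i) \<and>
      (\<forall>a. norm (tens a (G i) + lm a (M i) - rm a (M i) - tens (F i) a) \<le> K * norm a) \<and>
      ((\<lambda>l. q (G l) (M i)) \<longlongrightarrow> 0) U \<and> ((\<lambda>l. rm (f l) (M i)) \<longlongrightarrow> 0) U"
    using large[of B] comm_le q_lim rm_lim by eventually_elim (use f_le f_lim in blast)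
  then obtain i where i: "B < norm (F i)"
    "\<And>a. norm (tens a (G i) + lm a (M i) - rm a (M i) - tens (F i) a) \<le> K * norm a"
    "((\<lambda>l. q (G l) (M i)) \<longlongrightarrow> 0) U" "((\<lambda>l. rm (f l) (M i)) \<longlongrightarrow> 0) U"
    using eventually_happens'[OF U] by blast
  have ev_le: "\<forall>\<^sub>F l in U. norm (h l) < e" if "(h \<longlongrightarrow> 0) U" "0 < e" for h :: "'i \<Rightarrow> 'b::real_normed_vector" and e
    using tendstoD[OF that] by simp
  have "((\<lambda>l. G i - mul (G l) (G i)) \<longlongrightarrow> 0) U"
    using tendsto_diff[OF tendsto_const[of "G i"] left[of "G i"]] by simp
  from ev_le[OF this zero_less_one] ev_le[OF i(3) zero_less_one] left_le
  have "\<forall>\<^sub>F l in U. norm (G i - mul (G l) (G i)) < 1 \<and> norm (q (G l) (M i)) < 1 \<and>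
      (\<forall>a. norm (mul (G l) a) \<le> K * norm a)"
    by eventually_elim blast
  then obtain l where l: "norm (G i - mul (G l) (G i)) < 1" "norm (q (G l) (M i)) < 1"
    "\<And>a. norm (mul (G l) a) \<le> K * norm a"
    using eventually_happens'[OF U] by blast
  have "\<forall>\<^sub>F n in U. norm (mul (G l) (f n)) < 1 / 2 \<and> norm (rm (f n) (M i)) < 1 \<and> 0 < norm (F n)"
    using ev_le[OF f_lim[of "G l"] half_gt_zero[OF zero_less_one]] ev_le[OF i(4) zero_less_one] large[of 0]
    by eventually_elim auto
  then obtain n where n: "norm (mul (G l) (f n)) < 1 / 2" "norm (rm (f n) (M i)) < 1" "F n \<noteq> 0"
    using eventually_happens'[OF U] by fastforce
  define a where "a = f n"
  have a: "norm a = 1" using n(3) by (simp add: a_def f_def)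
  define t where "t = tens a (G i) + lm a (M i) - rm a (M i) - tens (F i) a"
  note lin = linear_add[OF q_linear] linear_diff[OF q_linear]
  have t: "norm t \<le> K" using i(2)[of a] a by (simp add: t_def)
  have q: "norm (q (G l) s) \<le> (1 + K) * norm s" for s using l(3) by (rule q_le)
  \<comment> \<open>\<open>q (G l)\<close> is applied to the definition of \<open>t\<close>, and the
    \<open>F i\<close> term is isolated. Smallness of the \<open>M i\<close> terms has two sources:
    \<open>q (G l) (M i)\<close> is small by the choice of \<open>l\<close>, and
    \<open>rm a (M i)\<close> by the later choice of \<open>n\<close>.\<close>
  have "tens (F i) (a - mul (G l) a) =
      tens a (G i - mul (G l) (G i)) + lm a (q (G l) (M i)) - q (G l) (rm a (M i)) - q (G l) t"
    by (simp add: t_def lin q_tens q_lm)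
  then have "norm (tens (F i) (a - mul (G l) a)) \<le> norm (tens a (G i - mul (G l) (G i))) +
      norm (lm a (q (G l) (M i))) + norm (q (G l) (rm a (M i))) + norm (q (G l) t)"
    by (smt (verit) norm_triangle_ineq norm_triangle_ineq4)
  also have "\<dots> \<le> 2 + 1 + (1 + K) + (1 + K) * K"
  proof (intro add_mono)
    show "norm (tens a (G i - mul (G l) (G i))) \<le> 2"
      using tens_le[of a "G i - mul (G l) (G i)"] l(1) a by simp
    show "norm (lm a (q (G l) (M i))) \<le> 1" using lm_le[of a "q (G l) (M i)"] l(2) a by simp
    have "norm (q (G l) (rm a (M i))) \<le> (1 + K) * norm (rm a (M i))" by (rule q)
    also have "\<dots> \<le> (1 + K) * 1" using n(2) K by (intro mult_left_mono) (auto simp: a_def)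
    finally show "norm (q (G l) (rm a (M i))) \<le> 1 + K" by simp
    have "norm (q (G l) t) \<le> (1 + K) * norm t" by (rule q)
    also have "\<dots> \<le> (1 + K) * K" using t K by (intro mult_left_mono) auto
    finally show "norm (q (G l) t) \<le> (1 + K) * K" .
  qed
  also have "\<dots> = B / 4" by (simp add: B_def algebra_simps)
  finally have up: "norm (tens (F i) (a - mul (G l) a)) \<le> B / 4" .
  have "1 / 2 \<le> norm (a - mul (G l) a)"
    using norm_triangle_ineq2[of a "mul (G l) a"] a n(1) by (simp add: a_def)
  then have "norm (F i) * (1 / 2) \<le> norm (F i) * norm (a - mul (G l) a)"
    by (intro mult_left_mono) auto
  also have "\<dots> \<le> 2 * (B / 4)" using tens_ge[of "F i" "a - mul (G l) a"] up by linarith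
  finally show False using i(1) by simp
qed

context banach_algebra_imaginary
begin

abbreviation lmult :: "'a \<Rightarrow> 'a \<Rightarrow>\<^sub>L 'a" where "lmult \<equiv> blinfun_mult_right"
abbreviation rmult :: "'a \<Rightarrow> 'a \<Rightarrow>\<^sub>L 'a" where "rmult \<equiv> blinfun_mult_left"

lemma lmult_tens: "lmult a o\<^sub>L tens x y = tens (a * x) y"
  by (simp add: compose_tens blinfun_mult_right.rep_eq scale_mult_right)

lemma rmult_tens: "rmult a o\<^sub>L tens x y = tens (x * a) y"
  by (simp add: compose_tens scale_mult_left)

lemma tens_lmult: "tens x y o\<^sub>L precomp (lmult a) = tens x (a * y)"
  by (simp add: tens_precomp blinfun_mult_right.rep_eq scale_mult_right)

lemma tens_rmult: "tens x y o\<^sub>L precomp (rmult a) = tens x (y * a)"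
  by (simp add: tens_precomp scale_mult_left)

lemma tens_diff_left: "tens (x - x') y = tens x y - tens x' y"
  using tens_add_left[of "x - x'" x' y] by simp

lemma tens_diff_right: "tens x (y - y') = tens x y - tens x y'"
  using tens_add_right[of x "y - y'" y'] by simp

lemma tendsto_tens_zero_left: "((\<lambda>i. tens (f i) y) \<longlongrightarrow> 0) F" if "(f \<longlongrightarrow> 0) F"
proof (rule Lim_null_comparison)
  show "\<forall>\<^sub>F i in F. norm (tens (f i) y) \<le> 2 * norm (f i) * norm y" by (simp add: norm_tens_le)
  show "((\<lambda>i. 2 * norm (f i) * norm y) \<longlongrightarrow> 0) F"
    using that by (auto intro!: tendsto_eq_intros)
qed

lemma tendsto_tens_zero_right: "((\<lambda>i. tens x (f i)) \<longlongrightarrow> 0) F" if "(f \<longlongrightarrow> 0) F"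
proof (rule Lim_null_comparison)
  show "\<forall>\<^sub>F i in F. norm (tens x (f i)) \<le> 2 * norm x * norm (f i)" by (simp add: norm_tens_le)
  show "((\<lambda>i. 2 * norm x * norm (f i)) \<longlongrightarrow> 0) F"
    using that by (auto intro!: tendsto_eq_intros)
qed

lemma norm_lmult: "norm (lmult a) \<le> norm a"
  by (rule norm_blinfun_bound) (simp_all add: blinfun_mult_right.rep_eq norm_mult_ineq)

lemma norm_rmult: "norm (rmult a) \<le> norm a"
  by (rule norm_blinfun_bound) (simp_all add: norm_mult_ineq mult.commute[of "norm a"])

lemma norm_lmult_compose: "norm (lmult a o\<^sub>L t) \<le> norm a * norm t" for t :: "'b::real_normed_vector \<Rightarrow>\<^sub>L 'a"
  using norm_blinfun_compose[of "lmult a" t] mult_right_mono[OF norm_lmult, of "norm t" a] by simp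

lemma norm_compose_precomp_rmult: "norm (t o\<^sub>L precomp (rmult a)) \<le> norm a * norm t"
  using norm_blinfun_compose[of t "precomp (rmult a)"] norm_precomp[of "rmult a"] norm_rmult[of a]
    mult_left_mono[of "norm (precomp (rmult a))" "norm a" "norm t"] by (simp add: mult.commute)

text \<open>Here \<open>q z\<close> subtracts left multiplication by \<open>z\<close> on the second
  factor. On x \<otimes> y the two limits required for \<open>M\<close> concern only
  \<open>y - G l * y\<close> and \<open>y * f l\<close>; uniform bounds carry them to all of
  \<open>tensors\<close>.\<close>

lemma frequently_bounded_right_identity:
  fixes F G :: "'i \<Rightarrow> 'a" and M :: "'i \<Rightarrow> ('a \<Rightarrow>\<^sub>L real) \<Rightarrow>\<^sub>L 'a"
  assumes U: "U \<noteq> bot" and K: "0 \<le> K"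
    and right: "\<And>a. ((\<lambda>i. a * F i) \<longlongrightarrow> a) U"
    and left: "\<And>a. ((\<lambda>i. G i * a) \<longlongrightarrow> a) U"
    and left_le: "\<forall>\<^sub>F i in U. \<forall>a. norm (G i * a) \<le> K * norm a"
    and comm_le: "\<forall>\<^sub>F i in U. \<forall>a. norm (tens a (G i) + (lmult a o\<^sub>L M i) -
      (M i o\<^sub>L precomp (rmult a)) - tens (F i) a) \<le> K * norm a"
    and M: "\<forall>\<^sub>F i in U. M i \<in> tensors"
  shows "\<exists>B. \<exists>\<^sub>F i in U. norm (F i) \<le> B"
proof -
  define q where "q = (\<lambda>z (t :: ('a \<Rightarrow>\<^sub>L real) \<Rightarrow>\<^sub>L 'a). t - (t o\<^sub>L precomp (lmult z)))"
  have q_le: "norm (q z t) \<le> (1 + K) * norm t" if "\<And>y. norm (z * y) \<le> K * norm y" for z t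
  proof -
    have "norm (lmult z) \<le> K" using K that by (intro norm_blinfun_bound) (simp_all add: blinfun_mult_right.rep_eq)
    then have "norm (precomp (lmult z)) \<le> K" using norm_precomp order_trans by blast
    then have "norm (t o\<^sub>L precomp (lmult z)) \<le> norm t * K"
      using norm_blinfun_compose[of t "precomp (lmult z)"] by (meson mult_left_mono norm_ge_zero order_trans)
    then show ?thesis
      using norm_triangle_ineq4[of t "t o\<^sub>L precomp (lmult z)"] by (simp add: q_def algebra_simps)
  qed
  have q_lin: "linear (q z)" for z unfolding q_def
    by (intro linear_compose_sub linear_ident bounded_linear.linear bounded_linear_ident
        bounded_bilinear.bounded_linear_left[OF bounded_bilinear_blinfun_compose])
  have q_tens: "q z (tens x y) = tens x (y - z * y)" for z x y
    by (simp add: q_def tens_lmult tens_diff_right)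
  show ?thesis
  proof (rule frequently_bounded_net[where mul = "(*)" and tens = tens and lm = "\<lambda>a t. lmult a o\<^sub>L t"
        and rm = "\<lambda>a t. t o\<^sub>L precomp (rmult a)" and q = q, OF U bounded_bilinear_mult K norm_tens_le
        norm_tens_ge norm_lmult_compose q_lin q_tens _ q_le right left left_le comm_le])
    show "q z (lmult a o\<^sub>L t) = lmult a o\<^sub>L q z t" for z a t
      by (rule blinfun_eqI) (simp add: q_def minus_blinfun.rep_eq blinfun_mult_right.rep_eq right_diff_distrib)
    show "\<forall>\<^sub>F i in U. ((\<lambda>l. q (G l) (M i)) \<longlongrightarrow> 0) U"
      using M
    proof eventually_elim
      case (elim i)
      show ?case
      proof (rule tensors_tendsto_zero[OF q_lin _ _ elim])
        show "\<forall>\<^sub>F l in U. \<forall>t. norm (q (G l) t) \<le> (1 + K) * norm t"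
          using left_le by eventually_elim (blast intro: q_le)
        show "((\<lambda>l. q (G l) (tens x y)) \<longlongrightarrow> 0) U" for x y
          unfolding q_tens
          using tendsto_diff[OF tendsto_const[of y] left[of y]] by (intro tendsto_tens_zero_right) simp
      qed
    qed
    show "\<forall>\<^sub>F i in U. \<forall>f. (\<forall>l. norm (f l) \<le> 1) \<longrightarrow> (\<forall>b. ((\<lambda>l. b * f l) \<longlongrightarrow> 0) U) \<longrightarrow>
        ((\<lambda>l. M i o\<^sub>L precomp (rmult (f l))) \<longlongrightarrow> 0) U"
      using M
    proof (eventually_elim, intro allI impI)
      fix i and f :: "'i \<Rightarrow> 'a"
      assume i: "M i \<in> tensors" and f: "\<forall>l. norm (f l) \<le> 1" "\<forall>b. ((\<lambda>l. b * f l) \<longlongrightarrow> 0) U"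
      show "((\<lambda>l. M i o\<^sub>L precomp (rmult (f l))) \<longlongrightarrow> 0) U"
      proof (rule tensors_tendsto_zero[where B = 1, OF _ _ _ i])
        show "linear (\<lambda>t. t o\<^sub>L precomp (rmult (f l)))" for l
          by (intro bounded_linear.linear bounded_bilinear.bounded_linear_left[OF bounded_bilinear_blinfun_compose])
        have "norm (t o\<^sub>L precomp (rmult (f l))) \<le> 1 * norm t" for l and t :: "('a \<Rightarrow>\<^sub>L real) \<Rightarrow>\<^sub>L 'a"
          using norm_compose_precomp_rmult[of t "f l"] f(1) by (meson mult_right_mono norm_ge_zero order_trans)
        then show "\<forall>\<^sub>F l in U. \<forall>t :: ('a \<Rightarrow>\<^sub>L real) \<Rightarrow>\<^sub>L 'a. norm (t o\<^sub>L precomp (rmult (f l))) \<le> 1 * norm t" by simp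
        show "((\<lambda>l. tens x y o\<^sub>L precomp (rmult (f l))) \<longlongrightarrow> 0) U" for x y
          unfolding tens_rmult using f(2) by (intro tendsto_tens_zero_right) blast
      qed
    qed
  qed
qed

text \<open>Reversing products and tensor factors exchanges \<open>F\<close> with \<open>G\<close>
  and the left with the right action, so that \<open>q z\<close> now acts on the first
  factor.\<close>

lemma frequently_bounded_left_identity:
  fixes F G :: "'i \<Rightarrow> 'a" and M :: "'i \<Rightarrow> ('a \<Rightarrow>\<^sub>L real) \<Rightarrow>\<^sub>L 'a"
  assumes U: "U \<noteq> bot" and K: "0 \<le> K"
    and right: "\<And>a. ((\<lambda>i. a * F i) \<longlongrightarrow> a) U"
    and left: "\<And>a. ((\<lambda>i. G i * a) \<longlongrightarrow> a) U"
    and right_le: "\<forall>\<^sub>F i in U. \<forall>a. norm (a * F i) \<le> K * norm a"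
    and comm_le: "\<forall>\<^sub>F i in U. \<forall>a. norm (tens a (G i) + (lmult a o\<^sub>L M i) -
      (M i o\<^sub>L precomp (rmult a)) - tens (F i) a) \<le> K * norm a"
    and M: "\<forall>\<^sub>F i in U. M i \<in> tensors"
  shows "\<exists>B. \<exists>\<^sub>F i in U. norm (G i) \<le> B"
proof -
  define q where "q = (\<lambda>z (t :: ('a \<Rightarrow>\<^sub>L real) \<Rightarrow>\<^sub>L 'a). t - (rmult z o\<^sub>L t))"
  have q_le: "norm (q z t) \<le> (1 + K) * norm t" if "\<And>y. norm (y * z) \<le> K * norm y" for z t
  proof -
    have "norm (rmult z) \<le> K" using K that by (intro norm_blinfun_bound) simp_all
    then have "norm (rmult z o\<^sub>L t) \<le> K * norm t"
      using norm_blinfun_compose[of "rmult z" t] by (meson mult_right_mono norm_ge_zero order_trans)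
    then show ?thesis
      using norm_triangle_ineq4[of t "rmult z o\<^sub>L t"] by (simp add: q_def algebra_simps)
  qed
  have q_lin: "linear (q z)" for z unfolding q_def
    by (intro linear_compose_sub linear_ident bounded_linear.linear bounded_linear_ident
        bounded_bilinear.bounded_linear_right[OF bounded_bilinear_blinfun_compose])
  have q_tens: "q z (tens y x) = tens (y - y * z) x" for z x y
    by (simp add: q_def rmult_tens tens_diff_left)
  \<comment> \<open>The mirrored expression is the negative of the original one.\<close>
  have comm_le': "\<forall>\<^sub>F i in U. \<forall>a. norm (tens (F i) a + (M i o\<^sub>L precomp (rmult a)) -
      (lmult a o\<^sub>L M i) - tens a (G i)) \<le> K * norm a"
    using comm_le
  proof eventually_elim
    case (elim i)
    have "tens (F i) a + (M i o\<^sub>L precomp (rmult a)) - (lmult a o\<^sub>L M i) - tens a (G i) =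
      - (tens a (G i) + (lmult a o\<^sub>L M i) - (M i o\<^sub>L precomp (rmult a)) - tens (F i) a)" for a
      by simp
    then show ?case using elim by (simp only: norm_minus_cancel simp_thms)
  qed
  show ?thesis
  proof (rule frequently_bounded_net[where mul = "\<lambda>x y. y * x" and tens = "\<lambda>x y. tens y x"
        and lm = "\<lambda>a t. t o\<^sub>L precomp (rmult a)" and rm = "\<lambda>a t. lmult a o\<^sub>L t" and q = q,
        OF U bounded_bilinear.flip[OF bounded_bilinear_mult] K _ _
        norm_compose_precomp_rmult q_lin q_tens _ q_le left right right_le comm_le'])
    show "norm (tens y x) \<le> 2 * norm x * norm y" for x y
      using norm_tens_le[of y x] by (simp add: algebra_simps)
    show "norm x * norm y \<le> 2 * norm (tens y x)" for x y
      using norm_tens_ge[of y x] by (simp add: mult.commute)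
    show "q z (t o\<^sub>L precomp (rmult a)) = q z t o\<^sub>L precomp (rmult a)" for z a t
      by (rule blinfun_eqI) (simp add: q_def minus_blinfun.rep_eq)
    show "\<forall>\<^sub>F i in U. ((\<lambda>l. q (F l) (M i)) \<longlongrightarrow> 0) U"
      using M
    proof eventually_elim
      case (elim i)
      show ?case
      proof (rule tensors_tendsto_zero[OF q_lin _ _ elim])
        show "\<forall>\<^sub>F l in U. \<forall>t. norm (q (F l) t) \<le> (1 + K) * norm t"
          using right_le by eventually_elim (blast intro: q_le)
        show "((\<lambda>l. q (F l) (tens x y)) \<longlongrightarrow> 0) U" for x y
          unfolding q_tens
          using tendsto_diff[OF tendsto_const[of x] right[of x]] by (intro tendsto_tens_zero_left) simp
      qed
    qed
    show "\<forall>\<^sub>F i in U. \<forall>f. (\<forall>l. norm (f l) \<le> 1) \<longrightarrow> (\<forall>b. ((\<lambda>l. f l * b) \<longlongrightarrow> 0) U) \<longrightarrow>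
        ((\<lambda>l. lmult (f l) o\<^sub>L M i) \<longlongrightarrow> 0) U"
      using M
    proof (eventually_elim, intro allI impI)
      fix i and f :: "'i \<Rightarrow> 'a"
      assume i: "M i \<in> tensors" and f: "\<forall>l. norm (f l) \<le> 1" "\<forall>b. ((\<lambda>l. f l * b) \<longlongrightarrow> 0) U"
      show "((\<lambda>l. lmult (f l) o\<^sub>L M i) \<longlongrightarrow> 0) U"
      proof (rule tensors_tendsto_zero[where B = 1, OF _ _ _ i])
        show "linear (\<lambda>t :: ('a \<Rightarrow>\<^sub>L real) \<Rightarrow>\<^sub>L 'a. lmult (f l) o\<^sub>L t)" for l
          by (intro bounded_linear.linear bounded_bilinear.bounded_linear_right[OF bounded_bilinear_blinfun_compose])
        have "norm (lmult (f l) o\<^sub>L t) \<le> 1 * norm t" for l and t :: "('a \<Rightarrow>\<^sub>L real) \<Rightarrow>\<^sub>L 'a"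
          using norm_lmult_compose[of "f l" t] f(1) by (meson mult_right_mono norm_ge_zero order_trans)
        then show "\<forall>\<^sub>F l in U. \<forall>t :: ('a \<Rightarrow>\<^sub>L real) \<Rightarrow>\<^sub>L 'a. norm (lmult (f l) o\<^sub>L t) \<le> 1 * norm t" by simp
        show "((\<lambda>l. lmult (f l) o\<^sub>L tens x y) \<longlongrightarrow> 0) U" for x y
          unfolding lmult_tens using f(2) by (intro tendsto_tens_zero_left) blast
      qed
    qed
  qed
qed

section \<open>Tensors over the unitization without the component 1 \<otimes> 1\<close>

section \<open>The bimodule and its derivation\<close>

text \<open>The triple \<open>(x, y, t)\<close> stands for x \<otimes> 1 + 1 \<otimes> y + t.
  Multiplying 1 \<otimes> y by \<open>a\<close> from the left gives a \<otimes> y, which moves into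
  the third component; likewise x \<otimes> 1 becomes x \<otimes> a under the right action.\<close>

definition diag_bimod :: "('k, 'a, 'a \<times> 'a \<times> (('a \<Rightarrow>\<^sub>L real) \<Rightarrow>\<^sub>L 'a)) bimod"
  where "diag_bimod = \<lparr>bcarrier = UNIV \<times> UNIV \<times> tensors, badd = (+), bzero = 0,
    bscale = (\<lambda>c (x, y, t). (scl c x, scl c y, scl_op c o\<^sub>L t)), bnorm = norm,
    lact = (\<lambda>a (x, y, t). (a * x, 0, tens a y + (lmult a o\<^sub>L t))),
    ract = (\<lambda>(x, y, t) a. (0, y * a, tens x a + (t o\<^sub>L precomp (rmult a))))\<rparr>"

lemma diag_bimod_simps [simp]:
  "bcarrier diag_bimod = UNIV \<times> UNIV \<times> tensors" "badd diag_bimod = (+)" "bzero diag_bimod = 0"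
  "bscale diag_bimod c (x, y, t) = (scl c x, scl c y, scl_op c o\<^sub>L t)" "bnorm diag_bimod = norm"
  "lact diag_bimod a (x, y, t) = (a * x, 0, tens a y + (lmult a o\<^sub>L t))"
  "ract diag_bimod (x, y, t) a = (0, y * a, tens x a + (t o\<^sub>L precomp (rmult a)))"
  by (simp_all add: diag_bimod_def)

lemmas compose_linear =
  bounded_bilinear.add_left[OF bounded_bilinear_blinfun_compose]
  bounded_bilinear.add_right[OF bounded_bilinear_blinfun_compose]

lemma scl_op_minus_one: "scl_op (- 1) o\<^sub>L t = - t" for t :: "'b::real_normed_vector \<Rightarrow>\<^sub>L 'a"
  by (rule blinfun_eqI) (simp add: uminus_blinfun.rep_eq)

lemma bdiff_diag_bimod [simp]: "bdiff diag_bimod u v = u - v"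
  by (cases v) (simp add: bdiff_def scl_op_minus_one flip: uminus_Pair)

text \<open>The lower bound is the upper bound applied to \<open>inverse c\<close>.\<close>

lemma norm_scl_op_compose: "norm (scl_op c o\<^sub>L t) = norm c * norm t" for t :: "'b::real_normed_vector \<Rightarrow>\<^sub>L 'a"
proof (rule antisym)
  have le: "norm (scl_op c o\<^sub>L t) \<le> norm c * norm t" for c and t :: "'b \<Rightarrow>\<^sub>L 'a"
  proof (rule norm_blinfun_bound)
    show "norm ((scl_op c o\<^sub>L t) x) \<le> norm c * norm t * norm x" for x
      using mult_left_mono[OF norm_blinfun[of t x], of "norm c"] by (simp add: norm_scale mult.assoc)
  qed simp
  show "norm (scl_op c o\<^sub>L t) \<le> norm c * norm t" by (rule le)
  show "norm c * norm t \<le> norm (scl_op c o\<^sub>L t)"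
  proof (cases "c = 0")
    case False
    have "scl_op (inverse c) o\<^sub>L (scl_op c o\<^sub>L t) = t"
      using False by (intro blinfun_eqI) simp
    then have "norm t \<le> norm (inverse c) * norm (scl_op c o\<^sub>L t)" using le by metis
    then have "norm c * norm t \<le> norm c * (norm (inverse c) * norm (scl_op c o\<^sub>L t))"
      by (simp add: mult_left_mono)
    then show ?thesis using False by (simp add: norm_inverse flip: mult.assoc)
  qed simp
qed

lemma norm_diag_scale: "norm (scl c x, scl c y, scl_op c o\<^sub>L t) = norm c * norm (x, y, t)"
proof -
  have "sqrt ((norm c * p)\<^sup>2 + (norm c * q)\<^sup>2) = norm c * sqrt (p\<^sup>2 + q\<^sup>2)" for p q
    by (simp add: power_mult_distrib real_sqrt_mult flip: distrib_left)
  then show ?thesis by (simp add: norm_Pair norm_scale norm_scl_op_compose del: real_sqrt_pow2)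
qed

lemma norm_triple_le: "norm (x, y, t) \<le> norm x + norm y + norm t"
  using norm_Pair_le[of x "(y, t)"] norm_Pair_le[of y t] by simp

lemma norm_triple_ge: "norm x \<le> norm (x, y, t)" "norm y \<le> norm (x, y, t)" "norm t \<le> norm (x, y, t)"
  using norm_fst_le[of x "(y, t)"] norm_snd_le[of "(y, t)" x] norm_fst_le[of y t] norm_snd_le[of t y]
  by auto

lemma norm_triple_leD:
  "norm (x, y, t) \<le> B \<Longrightarrow> norm x \<le> B \<and> norm y \<le> B \<and> norm t \<le> B"
  using norm_triple_ge order_trans by blast

lemma bounded_linear_compose_left: "bounded_linear (\<lambda>t. t o\<^sub>L s)"
  by (rule bounded_bilinear.bounded_linear_left[OF bounded_bilinear_blinfun_compose])

lemma bounded_linear_compose_right: "bounded_linear (\<lambda>t. s o\<^sub>L t)"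
  by (rule bounded_bilinear.bounded_linear_right[OF bounded_bilinear_blinfun_compose])

lemma tensors_scl_op: "t \<in> tensors \<Longrightarrow> scl_op c o\<^sub>L t \<in> tensors"
  by (erule tensors_image[OF bounded_linear_compose_right, rotated]) (simp add: tens_in flip: tens_scl_left)

lemma tensors_lmult: "t \<in> tensors \<Longrightarrow> lmult a o\<^sub>L t \<in> tensors"
  by (erule tensors_image[OF bounded_linear_compose_right, rotated]) (simp add: tens_in lmult_tens)

lemma tensors_rmult: "t \<in> tensors \<Longrightarrow> t o\<^sub>L precomp (rmult a) \<in> tensors"
  by (erule tensors_image[OF bounded_linear_compose_left, rotated]) (simp add: tens_in tens_rmult)

lemmas tensors_add = real_vector.subspace_add[OF subspace_tensors]

text \<open>A real-linear operator on the dual need not respect the scalars of \<open>'k\<close>;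
  elementary tensors do, and density extends this to the carrier.\<close>

lemma tensors_precomp_scl:
  assumes "t \<in> tensors"
  shows "t o\<^sub>L precomp (rmult (scl c a)) = scl_op c o\<^sub>L (t o\<^sub>L precomp (rmult a))"
  by (rule tensors_eq[OF bounded_linear_compose_left _ _ assms])
    (simp_all add: tens_rmult scale_mult_right tens_scl_right
      bounded_linear_compose[OF bounded_linear_compose_right bounded_linear_compose_left])

lemma scl_op_algebra:
  "scl_op (c + d) o\<^sub>L t = (scl_op c o\<^sub>L t) + (scl_op d o\<^sub>L t)"
  "scl_op c o\<^sub>L (scl_op d o\<^sub>L t) = scl_op (c * d) o\<^sub>L t"
  "scl_op 1 o\<^sub>L t = t"
  "lmult a o\<^sub>L (scl_op c o\<^sub>L t) = scl_op c o\<^sub>L (lmult a o\<^sub>L t)"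
  "lmult (scl c a) o\<^sub>L t = scl_op c o\<^sub>L (lmult a o\<^sub>L t)"
  "lmult (a + b) o\<^sub>L t = (lmult a o\<^sub>L t) + (lmult b o\<^sub>L t)"
  "lmult (a * b) o\<^sub>L t = lmult a o\<^sub>L (lmult b o\<^sub>L t)"
  for t :: "'b::real_normed_vector \<Rightarrow>\<^sub>L 'a"
  by (rule blinfun_eqI; simp add: plus_blinfun.rep_eq scale_left_distrib blinfun_mult_right.rep_eq
      scale_mult_left scale_mult_right distrib_right mult.assoc)+

text \<open>Both \<open>rmult\<close> and transposition reverse products, so composition with
  \<open>precomp (rmult a)\<close> is a right action.\<close>

lemma precomp_algebra:
  fixes t :: "('a \<Rightarrow>\<^sub>L real) \<Rightarrow>\<^sub>L 'a"
  shows "t o\<^sub>L precomp (rmult (a + b)) = (t o\<^sub>L precomp (rmult a)) + (t o\<^sub>L precomp (rmult b))"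
    and "t o\<^sub>L precomp (rmult (a * b)) = (t o\<^sub>L precomp (rmult a)) o\<^sub>L precomp (rmult b)"
    and "s o\<^sub>L (t o\<^sub>L precomp (rmult a)) = (s o\<^sub>L t) o\<^sub>L precomp (rmult a)"
proof -
  have "\<phi> o\<^sub>L rmult (a + b) = (\<phi> o\<^sub>L rmult a) + (\<phi> o\<^sub>L rmult b)" for \<phi> :: "'a \<Rightarrow>\<^sub>L real"
    by (rule blinfun_eqI) (simp add: plus_blinfun.rep_eq distrib_left blinfun.add_right)
  then show "t o\<^sub>L precomp (rmult (a + b)) = (t o\<^sub>L precomp (rmult a)) + (t o\<^sub>L precomp (rmult b))"
    by (intro blinfun_eqI) (simp add: plus_blinfun.rep_eq blinfun.add_right)
  have "\<phi> o\<^sub>L rmult (a * b) = (\<phi> o\<^sub>L rmult b) o\<^sub>L rmult a" for \<phi> :: "'a \<Rightarrow>\<^sub>L real"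
    by (rule blinfun_eqI) (simp add: mult.assoc)
  then show "t o\<^sub>L precomp (rmult (a * b)) = (t o\<^sub>L precomp (rmult a)) o\<^sub>L precomp (rmult b)"
    by (intro blinfun_eqI) simp
qed (rule blinfun_eqI, simp)

lemma tens_zero [simp]: "tens 0 y = 0" "tens x 0 = 0"
  using tens_add_left[of 0 0 y] tens_add_right[of x 0 0] by simp_all

lemma norm_diag_lact_le:
  "norm (a * x, 0 :: 'a, tens a y + (lmult a o\<^sub>L t)) \<le> 4 * norm a * norm (x, y, t)"
proof -
  have "norm (a * x, 0 :: 'a, tens a y + (lmult a o\<^sub>L t)) \<le>
      norm (a * x) + norm (tens a y) + norm (lmult a o\<^sub>L t)"
    using norm_triple_le[of "a * x" "0 :: 'a" "tens a y + (lmult a o\<^sub>L t)"]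
      norm_triangle_ineq[of "tens a y" "lmult a o\<^sub>L t"] by simp
  also have "\<dots> \<le> norm a * norm x + 2 * norm a * norm y + norm a * norm t"
    by (intro add_mono norm_mult_ineq norm_tens_le norm_lmult_compose)
  also have "\<dots> \<le> norm a * norm (x, y, t) + 2 * norm a * norm (x, y, t) + norm a * norm (x, y, t)"
    by (intro add_mono mult_left_mono norm_triple_ge) auto
  finally show ?thesis by simp
qed

lemma norm_diag_ract_le:
  "norm (0 :: 'a, y * a, tens x a + (t o\<^sub>L precomp (rmult a))) \<le> 4 * norm a * norm (x, y, t)"
proof -
  have "norm (0 :: 'a, y * a, tens x a + (t o\<^sub>L precomp (rmult a))) \<le>
      norm (y * a) + norm (tens x a) + norm (t o\<^sub>L precomp (rmult a))"
    using norm_triple_le[of "0 :: 'a" "y * a" "tens x a + (t o\<^sub>L precomp (rmult a))"]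
      norm_triangle_ineq[of "tens x a" "t o\<^sub>L precomp (rmult a)"] by simp
  also have "\<dots> \<le> norm a * norm y + 2 * norm a * norm x + norm a * norm t"
    using norm_mult_ineq[of y a] norm_tens_le[of x a] norm_compose_precomp_rmult[of t a]
    by (simp add: algebra_simps)
  also have "\<dots> \<le> norm a * norm (x, y, t) + 2 * norm a * norm (x, y, t) + norm a * norm (x, y, t)"
    by (intro add_mono mult_left_mono norm_triple_ge) auto
  finally show ?thesis by simp
qed

lemma diag_bimodule: "banach_bimodule scl diag_bimod"
proof (unfold_locales, goal_cases)
  \<comment> \<open>Goals 14, 28 and 29 are completeness and the boundedness of the two actions.
    Completeness holds because the carrier is closed in a Banach space.\<close>
  case (14 s)
  have "Cauchy s" using 14(2) by (simp add: Cauchy_iff)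
  then obtain l where l: "s \<longlonglongrightarrow> l" using Cauchy_convergent convergent_def by blast
  have "closed (UNIV \<times> UNIV \<times> tensors)" by (intro closed_Times closed_UNIV closed_tensors)
  then have "l \<in> UNIV \<times> UNIV \<times> tensors"
    using 14(1) l by (auto intro: closed_sequentially simp del: mem_Times_iff)
  then show ?case using l by (intro bexI[of _ l]) (simp_all add: LIM_zero tendsto_norm_zero)
next
  case 28
  show ?case using norm_diag_lact_le by (auto intro!: exI[of _ 4])
next
  case 29
  show ?case using norm_diag_ract_le by (auto intro!: exI[of _ 4])
qed (auto simp: zero_prod_def real_vector.subspace_0[OF subspace_tensors] tensors_add tensors_scl_op
    tensors_lmult tensors_rmult tens_in scale_right_distrib scale_left_distrib compose_linear
    norm_diag_scale scl_op_algebra precomp_algebra norm_triangle_ineq tens_add_left tens_add_right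
    tens_scl_left tens_scl_right scale_mult_left scale_mult_right tensors_precomp_scl
    distrib_left distrib_right mult.assoc lmult_tens tens_rmult algebra_simps)

text \<open>Formally this is the commutator with 1 \<otimes> 1, an element missing from the carrier.
  In the product rule the third components cancel, being -(a \<otimes> b) and a \<otimes> b.\<close>

lemma diag_derivation: "continuous_derivation scl diag_bimod (\<lambda>a. (a, - a, 0))"
  unfolding continuous_derivation_def
proof (intro conjI allI)
  have "norm (a, - a, 0 :: ('a \<Rightarrow>\<^sub>L real) \<Rightarrow>\<^sub>L 'a) \<le> 2 * norm a" for a :: 'a
    using norm_triple_le[of a "- a" 0] by simp
  then show "\<exists>C. \<forall>a. bnorm diag_bimod (a, - a, 0) \<le> C * norm a" by auto
  show "(a * b, - (a * b), 0) = badd diag_bimod (lact diag_bimod a (b, - b, 0)) (ract diag_bimod (a, - a, 0) b)" for a b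
    using tens_add_right[of a "- b" b] by simp
qed (auto simp: real_vector.subspace_0[OF subspace_tensors])

end

section \<open>From one-sided bounded identities to a two-sided one, and the conclusion\<close>

text \<open>
  The approximate identity is \<open>f + g - f * g\<close>: \<open>a - e * a\<close> is \<open>a - g * a\<close> minus its product with the
  bounded \<open>f\<close>, and symmetrically on the other side.
\<close>

lemma bounded_approximate_identityI:
  fixes U :: "'i filter" and V :: "'j filter" and f :: "'i \<Rightarrow> 'a::real_normed_algebra"
    and g :: "'j \<Rightarrow> 'a"
  assumes U: "U \<noteq> bot" "\<forall>\<^sub>F i in U. norm (f i) \<le> B" "\<And>a. ((\<lambda>i. a * f i) \<longlongrightarrow> a) U"
    and V: "V \<noteq> bot" "\<forall>\<^sub>F i in V. norm (g i) \<le> C" "\<And>a. ((\<lambda>i. g i * a) \<longlongrightarrow> a) V"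
  shows "has_bounded_approximate_identity TYPE('a)"
proof -
  \<comment> \<open>The one-sided identities are indexed by filters of their own, so both indices
    vary independently.\<close>
  define W where "W = U \<times>\<^sub>F V"
  define e where "e = (\<lambda>(i, l). f i + g l - f i * g l)"
  have W: "W \<noteq> bot" using U(1) V(1) by (simp add: W_def prod_filter_eq_bot)
  have "\<forall>\<^sub>F p in W. norm (f (fst p)) \<le> B \<and> norm (g (snd p)) \<le> C"
    unfolding W_def eventually_prod_filter using U(2) V(2) by force
  then have bound: "\<forall>\<^sub>F p in W. norm (f (fst p)) \<le> \<bar>B\<bar> \<and> norm (g (snd p)) \<le> \<bar>C\<bar>"
    by eventually_elim auto
  have fst: "((\<lambda>p. h (fst p)) \<longlongrightarrow> x) W" if "(h \<longlongrightarrow> x) U" for h :: "'i \<Rightarrow> 'a" and x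
    unfolding W_def by (rule filterlim_compose[OF that filterlim_fst])
  have snd: "((\<lambda>p. h (snd p)) \<longlongrightarrow> x) W" if "(h \<longlongrightarrow> x) V" for h :: "'j \<Rightarrow> 'a" and x
    unfolding W_def by (rule filterlim_compose[OF that filterlim_snd])
  have right: "((\<lambda>p. e p * a) \<longlongrightarrow> a) W" for a
  proof (rule Lim_transform2)
    have lim: "((\<lambda>p. (1 + \<bar>B\<bar>) * norm (g (snd p) * a - a)) \<longlongrightarrow> 0) W"
      by (intro tendsto_mult_right_zero tendsto_norm_zero LIM_zero snd V(3))
    show "((\<lambda>p. a - e p * a) \<longlongrightarrow> 0) W"
    proof (rule Lim_null_comparison[OF _ lim])
      show "\<forall>\<^sub>F p in W. norm (a - e p * a) \<le> (1 + \<bar>B\<bar>) * norm (g (snd p) * a - a)"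
        using bound
      proof eventually_elim
        case (elim p)
        define d where "d = g (snd p) * a - a"
        have "a - e p * a = f (fst p) * d - d"
          by (simp add: e_def d_def split_beta algebra_simps)
        then have "norm (a - e p * a) \<le> norm (f (fst p)) * norm d + norm d"
          using norm_triangle_ineq4[of "f (fst p) * d" d] norm_mult_ineq[of "f (fst p)" d] by simp
        also have "\<dots> \<le> \<bar>B\<bar> * norm d + norm d" using elim by (simp add: mult_right_mono)
        finally show ?case by (simp add: d_def algebra_simps)
      qed
    qed
  qed simp
  have left: "((\<lambda>p. a * e p) \<longlongrightarrow> a) W" for a
  proof (rule Lim_transform2)
    have lim: "((\<lambda>p. (1 + \<bar>C\<bar>) * norm (a * f (fst p) - a)) \<longlongrightarrow> 0) W"
      by (intro tendsto_mult_right_zero tendsto_norm_zero LIM_zero fst U(3))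
    show "((\<lambda>p. a - a * e p) \<longlongrightarrow> 0) W"
    proof (rule Lim_null_comparison[OF _ lim])
      show "\<forall>\<^sub>F p in W. norm (a - a * e p) \<le> (1 + \<bar>C\<bar>) * norm (a * f (fst p) - a)"
        using bound
      proof eventually_elim
        case (elim p)
        define d where "d = a * f (fst p) - a"
        have "a - a * e p = d * g (snd p) - d"
          by (simp add: e_def d_def split_beta algebra_simps)
        then have "norm (a - a * e p) \<le> norm d * norm (g (snd p)) + norm d"
          using norm_triangle_ineq4[of "d * g (snd p)" d] norm_mult_ineq[of d "g (snd p)"] by simp
        also have "\<dots> \<le> norm d * \<bar>C\<bar> + norm d" using elim by (simp add: mult_left_mono)
        finally show ?case by (simp add: d_def algebra_simps)
      qed
    qed
  qed simp
  have "\<forall>\<^sub>F p in W. norm (e p) \<le> \<bar>B\<bar> + \<bar>C\<bar> + \<bar>B\<bar> * \<bar>C\<bar>"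
    using bound
  proof eventually_elim
    case (elim p)
    have "norm (e p) \<le> norm (f (fst p)) + norm (g (snd p)) + norm (f (fst p)) * norm (g (snd p))"
      using norm_triangle_ineq4[of "f (fst p) + g (snd p)" "f (fst p) * g (snd p)"]
        norm_triangle_ineq[of "f (fst p)" "g (snd p)"] norm_mult_ineq[of "f (fst p)" "g (snd p)"]
      by (simp add: e_def split_beta)
    also have "\<dots> \<le> \<bar>B\<bar> + \<bar>C\<bar> + \<bar>B\<bar> * \<bar>C\<bar>" using elim by (intro add_mono mult_mono) auto
    finally show ?case .
  qed
  then show ?thesis unfolding has_bounded_approximate_identity_def
    using W right left
    by (intro exI[of _ "filtermap e W"] exI[of _ "\<bar>B\<bar> + \<bar>C\<bar> + \<bar>B\<bar> * \<bar>C\<bar>"])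
      (simp add: filtermap_bot_iff eventually_filtermap filterlim_filtermap)
qed

theorem corollary3p4:
  fixes scl :: "'k::{real_normed_field,banach} \<Rightarrow> 'a::{real_normed_algebra,banach} \<Rightarrow> 'a"
  assumes "banach_algebra scl"
    and "boundedly_approx_contractible scl"
  shows "has_bounded_approximate_identity TYPE('a)"
proof -
  obtain j :: 'k where j: "j = 0 \<or> j\<^sup>2 = -1" "\<And>c. \<exists>p q. c = of_real p + of_real q * j"
    using real_normed_field_real_or_complex[where 'k = 'k] by blast
  interpret banach_algebra scl by fact
  interpret banach_algebra_imaginary scl j using j by unfold_locales
  \<comment> \<open>The carrier consists of triples involving operators on the dual, hence the
    appeal to the version for all carrier types.\<close>
  have "boundedly_approximable diag_bimod (\<lambda>a. (a, - a, 0))"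
    using boundedly_approx_contractible_all_types[OF assms(2)] diag_bimodule diag_derivation
    unfolding boundedly_approx_contractible_on_def by blast
  then obtain U :: "('a \<Rightarrow> 'a \<times> 'a \<times> (('a \<Rightarrow>\<^sub>L real) \<Rightarrow>\<^sub>L 'a)) filter" and K' where U: "U \<noteq> bot"
    and inner: "\<forall>\<^sub>F T in U. inner_derivation diag_bimod T \<and> (\<forall>a. norm (T a) \<le> K' * norm a)"
    and lim: "\<And>a. ((\<lambda>T. norm (T a - (a, - a, 0))) \<longlongrightarrow> 0) U"
    unfolding boundedly_approximable_def diag_bimod_simps bdiff_diag_bimod by blast
  define K where "K = \<bar>K'\<bar>"
  have K: "0 \<le> K" by (simp add: K_def)
  \<comment> \<open>The three components of the inner derivation given by F \<otimes> 1 + 1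
    \<otimes> G + M.\<close>
  define P where "P = (\<lambda>T (F, G, M). M \<in> tensors \<and> (\<forall>a. T a = (a * F, - (G * a),
    tens a G + (lmult a o\<^sub>L M) - (M o\<^sub>L precomp (rmult a)) - tens F a)))"
  have "\<exists>u. P T u" if "inner_derivation diag_bimod T" for T
  proof -
    from that obtain F G M where "M \<in> tensors"
      "\<And>a. T a = lact diag_bimod a (F, G, M) - ract diag_bimod (F, G, M) a"
      unfolding inner_derivation_def by auto
    then show ?thesis by (intro exI[of _ "(F, G, M)"]) (simp add: P_def algebra_simps)
  qed
  \<comment> \<open>An implementing triple is chosen for each operator, so the filter
    \<open>U\<close> on operators itself indexes \<open>F\<close>, \<open>G\<close> and
    \<open>M\<close>.\<close>
  then obtain w where w: "\<And>T. inner_derivation diag_bimod T \<Longrightarrow> P T (w T)" by metis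
  define F G M where "F = fst \<circ> w" and "G = fst \<circ> snd \<circ> w" and "M = snd \<circ> snd \<circ> w"
  have ev: "\<forall>\<^sub>F T in U. M T \<in> tensors \<and> (\<forall>a. norm (T a) \<le> K * norm a \<and> T a = (a * F T, - (G T * a),
      tens a (G T) + (lmult a o\<^sub>L M T) - (M T o\<^sub>L precomp (rmult a)) - tens (F T) a))"
    using inner
  proof eventually_elim
    case (elim T)
    have "norm (T a) \<le> K * norm a" for a
    proof (rule order_trans)
      show "norm (T a) \<le> K' * norm a" using elim by blast
      show "K' * norm a \<le> K * norm a" by (simp add: K_def mult_right_mono)
    qed
    moreover have "P T (F T, G T, M T)" using w[OF conjunct1[OF elim]] by (simp add: F_def G_def M_def)
    ultimately show ?case by (simp add: P_def)
  qed
  have lim': "((\<lambda>T. T a) \<longlongrightarrow> (a, - a, 0)) U" for a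
    using lim[of a] by (rule LIM_zero_cancel[OF tendsto_norm_zero_cancel])
  have right: "((\<lambda>T. a * F T) \<longlongrightarrow> a) U" for a
  proof (rule Lim_transform_eventually)
    show "((\<lambda>T. fst (T a)) \<longlongrightarrow> a) U" using tendsto_fst[OF lim'[of a]] by simp
    show "\<forall>\<^sub>F T in U. fst (T a) = a * F T" using ev by eventually_elim simp
  qed
  have left: "((\<lambda>T. G T * a) \<longlongrightarrow> a) U" for a
  proof (rule Lim_transform_eventually)
    show "((\<lambda>T. - fst (snd (T a))) \<longlongrightarrow> a) U"
      using tendsto_minus[OF tendsto_fst[OF tendsto_snd[OF lim'[of a]]]] by simp
    show "\<forall>\<^sub>F T in U. - fst (snd (T a)) = G T * a"
      using ev by eventually_elim simp
  qed
  have bounds: "\<forall>\<^sub>F T in U. \<forall>a. norm (a * F T) \<le> K * norm a \<and> norm (G T * a) \<le> K * norm a \<and>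
      norm (tens a (G T) + (lmult a o\<^sub>L M T) - (M T o\<^sub>L precomp (rmult a)) - tens (F T) a) \<le> K * norm a"
    using ev
  proof (eventually_elim, intro allI)
    fix T a
    assume T: "M T \<in> tensors \<and> (\<forall>a. norm (T a) \<le> K * norm a \<and> T a = (a * F T, - (G T * a),
      tens a (G T) + (lmult a o\<^sub>L M T) - (M T o\<^sub>L precomp (rmult a)) - tens (F T) a))"
    then have "norm (a * F T, - (G T * a), tens a (G T) + (lmult a o\<^sub>L M T) -
        (M T o\<^sub>L precomp (rmult a)) - tens (F T) a) \<le> K * norm a" by metis
    then show "norm (a * F T) \<le> K * norm a \<and> norm (G T * a) \<le> K * norm a \<and>
        norm (tens a (G T) + (lmult a o\<^sub>L M T) - (M T o\<^sub>L precomp (rmult a)) - tens (F T) a) \<le> K * norm a"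
      by (auto dest!: norm_triple_leD)
  qed
  have tensors: "\<forall>\<^sub>F T in U. M T \<in> tensors" using ev by eventually_elim blast
  \<comment> \<open>What holds frequently along \<open>U\<close> holds eventually along a finer
    proper filter, the counterpart of a subnet, and limits along \<open>U\<close> persist there. The
    filters obtained for \<open>F\<close> and \<open>G\<close> may differ.\<close>
  have sub: "inf U (principal {T. Q T}) \<noteq> bot \<and> eventually Q (inf U (principal {T. Q T}))"
    if "\<exists>\<^sub>F T in U. Q T" for Q
    using that by (simp add: trivial_limit_def eventually_inf_principal frequently_def)
  have "\<exists>B. \<exists>\<^sub>F T in U. norm (F T) \<le> B"
    using bounds by (intro frequently_bounded_right_identity[OF U K right left _ _ tensors])
      (simp_all add: eventually_mono[OF bounds])
  then obtain B where "\<exists>\<^sub>F T in U. norm (F T) \<le> B" ..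
  note F = sub[OF this]
  have "\<exists>B. \<exists>\<^sub>F T in U. norm (G T) \<le> B"
    using bounds by (intro frequently_bounded_left_identity[OF U K right left _ _ tensors])
      (simp_all add: eventually_mono[OF bounds])
  then obtain C where "\<exists>\<^sub>F T in U. norm (G T) \<le> C" ..
  note G = sub[OF this]
  show ?thesis
    by (rule bounded_approximate_identityI[OF conjunct1[OF F] conjunct2[OF F] _ conjunct1[OF G] conjunct2[OF G]])
      (auto intro: tendsto_mono[OF inf_le1] right left)
qed

end
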